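(* Fix $x\in\mathcal{X}$ and write $H(\theta)=H(x,\theta)$. Assume: (i) $\Theta\subset\mathbb{R}^l$ is compact; (ii) for every $n$, $\mathbb{P}^n_\theta$ has a density $p^n_\theta(\cdot)$ (with respect to a $\sigma$-finite measure on $\Xi^n$ not depending on $\theta$) that is jointly measurable in $\theta\in\Theta$ and its argument in $\Xi^n$ (write $p_\theta=p_\theta^1$); (iii) for any neighborhood $V\in\mathcal{B}_\Theta$ of $\theta^c$ there exists a sequence of uniformly consistent tests of the hypothesis $\tilde\theta=\theta^c$ against the alternative $\tilde\theta\in\Theta\setminus V$; (iv) for any $\epsilon>0$ and any neighborhood $V\in\mathcal{B}_\Theta$ of $\theta^c$, $V$ contains a subset $W$ with $\pi(W)>0$ and $D_{KL}(p_{\theta^c}\|p_\theta)<\epsilon$ for all $\theta\in W$; (v) there is a constant $\gamma>0$ such that for all $\epsilon>0$ there exists $M_\epsilon>0$ with $\mathbb{P}^{\mathbb{N}}_{\theta^c}\{\mathbb{E}_{\mathbb{P}_n}[\|\sqrt n(\theta-\theta^c)\|^{1+\gamma}]>M_\epsilon\}<\epsilon$ for all $n$; (vi) (standing assumption) the Bernstein–von Mises property and the asymptotic normality of the posterior mean described in the context hold; (vii) $H$ is differentiable at $\theta^c$; (viii) $\mathbb{P}^{\mathbb{N}}_{\theta^c}$-almost surely, for all $n$, when $\theta\sim\mathbb{P}_n$ the random variables $\sqrt n(\theta-\theta^c)$ and $\sqrt n[H(\theta)-H(\theta^c)]$ have positive densities (with respect to Lebesgue measure, positive on their respective sets of possible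 values). Then for any $\alpha\in(0,1)$, under $\mathbb{P}^{\mathbb{N}}_{\theta^c}$, as $n\to\infty$, $$\sqrt n\{\mathrm{VaR}^\alpha_{\mathbb{P}_n}[H(\theta)]-H(\theta^c)\}\Rightarrow\mathcal{N}(\sigma_x\Phi^{-1}(\alpha),\sigma_x^2),$$ where $\sigma_x^2:=\nabla_\theta H(x,\theta^c)^\top[I(\theta^c)]^{-1}\nabla_\theta H(x,\theta^c)$, $\sigma_x\ge 0$, and $\Phi$ is the standard normal distribution function.
   Context: Setting. $\Theta\subset\mathbb{R}^l$ carries its Borel $\sigma$-algebra $\mathcal{B}_\Theta$ and a prior probability measure $\pi$; $\Xi\subset\mathbb{R}^m$ carries its Borel $\sigma$-algebra and a family of probability measures $\{\mathbb{P}_\theta\}_{\theta\in\Theta}$. $\mathbb{P}^n_\theta$ and $\mathbb{P}^{\mathbb{N}}_\theta$ are the $n$-fold and countably infinite product measures; it is assumed that $\theta\mapsto\mathbb{P}^{\mathbb{N}}_\theta(B)$ is measurable for every measurable $B\subset\Xi^{\mathbb{N}}$. $\theta^c\in\Theta$ is the fixed true parameter; the data $\xi_1,\xi_2,\dots$ are the coordinates on $\Xi^{\mathbb{N}}$ (i.i.d. $\mathbb{P}_{\theta^c}$ under $\mathbb{P}^{\mathbb{N}}_{\theta^c}$). $\tilde\theta$ denotes the Bayesian parameter with prior $\pi$, and $\mathbb{P}_n$ is its posterior given $\xi_1,\dots,\xi_n$: $\mathbb{P}_n(A)=\int_A p^n_\theta(\xi_1,\dots,\xi_n)\pi(d\theta)/\int_\Theta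 p^n_\theta(\xi_1,\dots,\xi_n)\pi(d\theta)$. $\mathcal{X}\subset\mathbb{R}^d$ is closed, $h:\mathbb{R}^d\times\mathbb{R}^m\to\mathbb{R}$, and $H(x,\theta):=\mathbb{E}_{\mathbb{P}_\theta}[h(x,\xi)]$ is assumed finite for all $(x,\theta)\in\mathcal{X}\times\Theta$. $\mathrm{VaR}^\alpha(X):=\inf\{t:\mathbb{P}(X\le t)\ge\alpha\}$, and $\mathrm{VaR}^\alpha_{\mathbb{P}_n}[H(\theta)]$ is the VaR of $H(\theta)$ with $\theta\sim\mathbb{P}_n$. $\|\cdot\|$ is the Euclidean norm; $\Rightarrow$ is convergence in distribution; $D_{KL}$ is the Kullback–Leibler divergence. Uniformly consistent tests of $\tilde\theta=\theta^c$ against $\tilde\theta\in\Theta\setminus V$: measurable $\varphi_n:\Xi^n\to[0,1]$ with $\mathbb{E}_{\mathbb{P}^n_{\theta^c}}[\varphi_n]\to0$ and $\sup_{\theta\in\Theta\setminus V}\mathbb{E}_{\mathbb{P}^n_\theta}[1-\varphi_n]\to0$. Standing assumption (vi): $I(\theta^c)$, the Fisher information matrix of one observation $\xi_i$ at $\theta^c$, exists and is invertible; with $\mathbb{P}_{Z_n}$ the law of $\sqrt n(\theta-\theta^c)$ for $\theta\sim\mathbb{P}_n$, there are random vectors $\Delta_n$ (functions of $\xi_1,\dots,\xi_n$) with $\Delta_n\Rightarrow\mathcal{N}(0,[I(\theta^c)]^{-1})$ and $\|\mathbb{P}_{Z_n}-\mathcal{N}(\Delta_n,[I(\theta^c)]^{-1})\|_{TV}\to0$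 in $\mathbb{P}^{\mathbb{N}}_{\theta^c}$-probability, where $\|\mu-\nu\|_{TV}=\sup_A|\mu(A)-\nu(A)|$; and $\sqrt n(\mathbb{E}_{\mathbb{P}_n}[\theta]-\theta^c)\Rightarrow\mathcal{N}(0,[I(\theta^c)]^{-1})$ under $\mathbb{P}^{\mathbb{N}}_{\theta^c}$. *)

theory Defs
  imports "HOL-Probability.Probability"
begin

abbreviation borel_on :: "'a::topological_space set \<Rightarrow> 'a measure" where
  "borel_on S \<equiv> restrict_space borel S"

(* Xi^n and Xi^N with their product sigma-algebras; the observations xi_1, ..., xi_n are the
   coordinates 0, ..., n - 1. *)

abbreviation sample_space :: "nat \<Rightarrow> 'b::topological_space set \<Rightarrow> (nat \<Rightarrow> 'b) measure" where
  "sample_space n \<Xi> \<equiv> PiM {..<n} (\<lambda>_. borel_on \<Xi>)"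

abbreviation sequence_space :: "'b::topological_space set \<Rightarrow> (nat \<Rightarrow> 'b) measure" where
  "sequence_space \<Xi> \<equiv> PiM UNIV (\<lambda>_. borel_on \<Xi>)"

abbreviation sample_law :: "nat \<Rightarrow> 'b measure \<Rightarrow> (nat \<Rightarrow> 'b) measure" where
  "sample_law n \<mu> \<equiv> PiM {..<n} (\<lambda>_. \<mu>)"

abbreviation sequence_law :: "'b measure \<Rightarrow> (nat \<Rightarrow> 'b) measure" where
  "sequence_law \<mu> \<equiv> PiM UNIV (\<lambda>_. \<mu>)"

(* Neighbourhoods are relative to \<Theta>; the point c need not be interior to \<Theta> in the
   ambient space. *)
definition borel_nbhd :: "'a::topological_space set \<Rightarrow> 'a \<Rightarrow> 'a set \<Rightarrow> bool" where
  "borel_nbhd \<Theta> c V \<longleftrightarrow>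
     V \<in> sets (borel_on \<Theta>) \<and> (\<exists>U. open U \<and> c \<in> U \<and> U \<inter> \<Theta> \<subseteq> V)"

(* On samples with normalising constant 0 or infinity this is the zero measure. *)
definition posterior ::
  "'a measure \<Rightarrow> (nat \<Rightarrow> 'a \<Rightarrow> (nat \<Rightarrow> 'b) \<Rightarrow> real) \<Rightarrow> nat \<Rightarrow> (nat \<Rightarrow> 'b) \<Rightarrow> 'a measure" where
  "posterior \<pi> p n \<omega> =
     density \<pi> (\<lambda>\<theta>. ennreal (p n \<theta> (restrict \<omega> {..<n})) /
                    (\<integral>\<^sup>+\<theta>'. ennreal (p n \<theta>' (restrict \<omega> {..<n})) \<partial>\<pi>))"

lemma emeasure_posterior:
  assumes "(\<lambda>\<theta>. p n \<theta> (restrict \<omega> {..<n})) \<in> borel_measurable \<pi>" and "A \<in> sets \<pi>"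
  shows "emeasure (posterior \<pi> p n \<omega>) A =
    (\<integral>\<^sup>+\<theta>\<in>A. ennreal (p n \<theta> (restrict \<omega> {..<n})) \<partial>\<pi>) /
    (\<integral>\<^sup>+\<theta>. ennreal (p n \<theta> (restrict \<omega> {..<n})) \<partial>\<pi>)"
proof -
  note assms(1)[measurable]
  show ?thesis
    unfolding posterior_def using assms(2)
    by (simp add: emeasure_density divide_ennreal_def mult_ac flip: nn_integral_cmult)
qed

definition expected_cost :: "('a \<Rightarrow> 'b measure) \<Rightarrow> ('d \<Rightarrow> 'b \<Rightarrow> real) \<Rightarrow> 'd \<Rightarrow> 'a \<Rightarrow> real" where
  "expected_cost P h x \<theta> = (\<integral>\<xi>. h x \<xi> \<partial>P \<theta>)"

definition VaR :: "real \<Rightarrow> 'a measure \<Rightarrow> ('a \<Rightarrow> real) \<Rightarrow> real" where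
  "VaR \<alpha> M X = Inf {t. \<alpha> \<le> measure M {\<omega> \<in> space M. X \<omega> \<le> t}}"

(* D(P || Q) with value infinity allowed.  The library's KL_divergence takes the reference measure Q
   first and is a Bochner integral, so it returns a meaningless real number when P is not absolutely
   continuous w.r.t. Q or the log-density is not P-integrable.  Its negative part is
   always P-integrable for probability measures, so non-integrability means D(P || Q) is infinite. *)
definition KL_div :: "'a measure \<Rightarrow> 'a measure \<Rightarrow> ereal" where
  "KL_div P Q =
     (if absolutely_continuous Q P \<and> integrable P (entropy_density (exp 1) Q P)
      then ereal (KL_divergence (exp 1) Q P) else \<infinity>)"

(* The supremum is taken in ennreal so that it is 0 when \<Theta> = V. *)
definition uniformly_consistent_tests ::
  "'a set \<Rightarrow> 'b::topological_space set \<Rightarrow> ('a \<Rightarrow> 'b measure) \<Rightarrow> 'a \<Rightarrow> 'a set \<Rightarrow>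
   (nat \<Rightarrow> (nat \<Rightarrow> 'b) \<Rightarrow> real) \<Rightarrow> bool" where
  "uniformly_consistent_tests \<Theta> \<Xi> P c V \<phi> \<longleftrightarrow>
     (\<forall>n\<ge>1. \<phi> n \<in> borel_measurable (sample_space n \<Xi>) \<and>
             (\<forall>y \<in> space (sample_space n \<Xi>). \<phi> n y \<in> {0..1})) \<and>
     (\<lambda>n. \<integral>y. \<phi> n y \<partial>sample_law n (P c)) \<longlonglongrightarrow> 0 \<and>
     (\<lambda>n. SUP \<theta>\<in>\<Theta> - V. ennreal (\<integral>y. 1 - \<phi> n y \<partial>sample_law n (P \<theta>))) \<longlonglongrightarrow> 0"

(* J is the expectation under M, the law of the observation at parameter c, of s s^T, where s is the
   score, i.e. the gradient of \<theta> \<mapsto> ln (q \<theta> y) at c.  As ln 0 = 0 in HOL,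
   positivity of the density near c is stated explicitly. *)
definition has_fisher_information ::
  "'y measure \<Rightarrow> (real^'l \<Rightarrow> 'y \<Rightarrow> real) \<Rightarrow> (real^'l) set \<Rightarrow> real^'l \<Rightarrow> real^'l^'l \<Rightarrow> bool" where
  "has_fisher_information M q \<Theta> c J \<longleftrightarrow>
     (\<exists>s. (AE y in M. 0 < q c y \<and> (\<forall>\<^sub>F \<theta> in at c within \<Theta>. 0 < q \<theta> y) \<and>
              ((\<lambda>\<theta>. ln (q \<theta> y)) has_derivative (\<lambda>v. s y \<bullet> v)) (at c within \<Theta>)) \<and>
          (\<forall>i j. integrable M (\<lambda>y. s y $ i * s y $ j)) \<and>
          J = (\<chi> i j. \<integral>y. s y $ i * s y $ j \<partial>M))"

(* Nondegenerate normal law, for a positive definite covariance matrix. *)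
definition mvnormal :: "real^'l \<Rightarrow> real^'l^'l \<Rightarrow> (real^'l) measure" where
  "mvnormal \<mu> \<Sigma> =
     density lborel (\<lambda>z. ennreal (exp (- ((z - \<mu>) \<bullet> (matrix_inv \<Sigma> *v (z - \<mu>))) / 2) /
                                   sqrt ((2 * pi) ^ CARD('l) * det \<Sigma>)))"

(* Normal law on the line with mean \<mu> and standard deviation \<sigma> \<ge> 0. *)
definition normal_law :: "real \<Rightarrow> real \<Rightarrow> real measure" where
  "normal_law \<mu> \<sigma> =
     (if \<sigma> = 0 then return borel \<mu> else density lborel (\<lambda>z. ennreal (normal_density \<mu> \<sigma> z)))"

definition std_normal_cdf :: "real \<Rightarrow> real" where
  "std_normal_cdf = cdf (normal_law 0 1)"

definition TV_dist :: "'a::topological_space measure \<Rightarrow> 'a measure \<Rightarrow> real" where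
  "TV_dist \<mu> \<nu> = (SUP A\<in>sets borel. \<bar>measure \<mu> A - measure \<nu> A\<bar>)"

(* Weak convergence of laws on a Euclidean space; the library's weak_conv_m is for the line only. *)
definition weak_conv_vec :: "(nat \<Rightarrow> 'a::euclidean_space measure) \<Rightarrow> 'a measure \<Rightarrow> bool" where
  "weak_conv_vec \<mu> \<nu> \<longleftrightarrow>
     (\<forall>f::'a \<Rightarrow> real. continuous_on UNIV f \<longrightarrow> bounded (range f) \<longrightarrow>
        (\<lambda>n. \<integral>z. f z \<partial>\<mu> n) \<longlonglongrightarrow> (\<integral>z. f z \<partial>\<nu>))"

definition conv_in_prob :: "'w measure \<Rightarrow> (nat \<Rightarrow> 'w \<Rightarrow> real) \<Rightarrow> real \<Rightarrow> bool" where
  "conv_in_prob M X c \<longleftrightarrow>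
     (\<forall>n. X n \<in> borel_measurable M) \<and>
     (\<forall>\<epsilon>>0. (\<lambda>n. measure M {\<omega> \<in> space M. \<epsilon> < \<bar>X n \<omega> - c\<bar>}) \<longlonglongrightarrow> 0)"

(* Densities are determined up to null sets, so some version is required to be positive on S. *)
definition has_positive_density_on :: "'a::euclidean_space measure \<Rightarrow> 'a set \<Rightarrow> bool" where
  "has_positive_density_on M S \<longleftrightarrow>
     (\<exists>f::'a \<Rightarrow> real. f \<in> borel_measurable borel \<and> (\<forall>z. 0 \<le> f z) \<and> (\<forall>z\<in>S. 0 < f z) \<and>
        M = density lborel (\<lambda>z. ennreal (f z)))"

end

theory Submission
  imports Defs
begin

text \<open>By the Bernstein--von Mises property and differentiability, under the posterior the variable
  \<open>sqrt n * (H \<theta> - H \<theta>c)\<close> is, up to an error that vanishes in probability, the linear functional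
  \<open>gradH \<bullet> z\<close> of a normal vector \<open>z\<close> with mean \<open>\<Delta> n\<close> and covariance \<open>matrix_inv J\<close>.
  Its distribution function therefore crosses the level \<open>\<alpha>\<close> near
  \<open>gradH \<bullet> \<Delta> n + \<sigma> * inv std_normal_cdf \<alpha>\<close>, because the limiting distribution function is strictly
  increasing through \<open>\<alpha>\<close> there (or jumps over \<open>\<alpha>\<close> if \<open>\<sigma> = 0\<close>). Slutsky's lemma and the asymptotic normality
  of \<open>\<Delta> n\<close> conclude.\<close>

section \<open>Fisher information as a Gram matrix, and Gaussian weights along one direction\<close>

lemma nn_integral_lborel_shift:
  fixes f :: "'a::euclidean_space \<Rightarrow> ennreal"
  assumes [measurable]: "f \<in> borel_measurable borel"
  shows "(\<integral>\<^sup>+z. f (c + z) \<partial>lborel) = (\<integral>\<^sup>+z. f z \<partial>lborel)"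
proof -
  have "(\<integral>\<^sup>+z. f z \<partial>lborel) = (\<integral>\<^sup>+z. f z \<partial>distr lborel borel ((+) c))"
    by (simp add: lborel_distr_plus)
  also have "\<dots> = (\<integral>\<^sup>+z. f (c + z) \<partial>lborel)"
    by (subst nn_integral_distr) auto
  finally show ?thesis ..
qed

text \<open>Expanding both inner products in coordinates leaves a finite sum of integrable terms. In
  this coordinate-free form the definiteness of \<open>J\<close> can be read off the
  integrand.\<close>

lemma has_fisher_information_inner:
  fixes J :: "real^'l^'l"
  assumes "has_fisher_information M q \<Theta> c J"
  obtains s where "\<And>u w. integrable M (\<lambda>y. (s y \<bullet> u) * (s y \<bullet> w))"
    and "\<And>u w. u \<bullet> (J *v w) = (\<integral>y. (s y \<bullet> u) * (s y \<bullet> w) \<partial>M)"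
proof -
  from assms obtain s where int: "\<And>i j. integrable M (\<lambda>y. s y $ i * s y $ j)"
    and J: "J = (\<chi> i j. \<integral>y. s y $ i * s y $ j \<partial>M)"
    unfolding has_fisher_information_def by blast
  have prod: "(s y \<bullet> u) * (s y \<bullet> w) = (\<Sum>i\<in>UNIV. \<Sum>j\<in>UNIV. (u $ i * w $ j) * (s y $ i * s y $ j))"
    for y u w by (simp add: inner_vec_def sum_product mult_ac)
  have "integrable M (\<lambda>y. (s y \<bullet> u) * (s y \<bullet> w))" for u w
    unfolding prod by (intro Bochner_Integration.integrable_sum integrable_mult_right int)
  moreover have "u \<bullet> (J *v w) = (\<integral>y. (s y \<bullet> u) * (s y \<bullet> w) \<partial>M)" for u w
    unfolding prod
    by (subst Bochner_Integration.integral_sum;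
        (intro Bochner_Integration.integrable_sum integrable_mult_right int)?)+
       (simp add: J inner_vec_def matrix_vector_mult_def sum_distrib_left mult_ac
         Bochner_Integration.integral_sum int)
  ultimately show ?thesis by (rule that)
qed

text \<open>All three facts hold because \<open>J\<close> is the Gram matrix of the score
  \<open>s\<close>: a product commutes, and a square is nonnegative. If the second moment of
  \<open>s y \<bullet> v\<close> vanishes, then \<open>s y \<bullet> v\<close> is almost surely 0,
  so its pairing with every other direction vanishes as well.\<close>

lemma
  fixes J :: "real^'l^'l"
  assumes "has_fisher_information M q \<Theta> c J"
  shows fisher_information_sym: "u \<bullet> (J *v w) = w \<bullet> (J *v u)"
    and fisher_information_nonneg: "0 \<le> v \<bullet> (J *v v)"
    and fisher_information_eq_0: "v \<bullet> (J *v v) = 0 \<Longrightarrow> J *v v = 0"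
proof -
  obtain s where int: "\<And>u w. integrable M (\<lambda>y. (s y \<bullet> u) * (s y \<bullet> w))"
    and J: "\<And>u w. u \<bullet> (J *v w) = (\<integral>y. (s y \<bullet> u) * (s y \<bullet> w) \<partial>M)"
    using has_fisher_information_inner[OF assms] by blast
  show "u \<bullet> (J *v w) = w \<bullet> (J *v u)" by (simp add: J mult.commute)
  show "0 \<le> v \<bullet> (J *v v)" unfolding J by (rule Bochner_Integration.integral_nonneg) simp
  assume 0: "v \<bullet> (J *v v) = 0"
  have "AE y in M. (s y \<bullet> v) * (s y \<bullet> v) = 0"
    using integral_nonneg_eq_0_iff_AE[OF int[of v v]] 0 by (simp add: J)
  \<comment> \<open>Choosing \<open>J *v v\<close> as the other direction turns the pairing into the
    squared norm of \<open>J *v v\<close>.\<close>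
  then have "AE y in M. (s y \<bullet> (J *v v)) * (s y \<bullet> v) = 0" by eventually_elim auto
  then have "(J *v v) \<bullet> (J *v v) = 0"
    unfolding J[of "J *v v" v] by (rule integral_eq_zero_AE)
  then show "J *v v = 0" by simp
qed

text \<open>The shift of \<open>z\<close> by \<open>s *\<^sub>R v\<close> multiplies the Gaussian weight by a function of
  \<open>g \<bullet> z\<close> alone; averaging over \<open>s\<close> disintegrates the weight along \<open>g \<bullet> z\<close> without
  diagonalising \<open>J\<close> or computing a determinant.\<close>
lemma nn_integral_gaussian_linear:
  fixes J :: "real^'l^'l" and g v :: "real^'l"
  assumes sym: "\<And>u w. u \<bullet> (J *v w) = w \<bullet> (J *v u)" and v: "J *v v = g" and r: "r = g \<bullet> v" "r > 0"
  shows "\<exists>C. \<forall>\<phi>\<in>borel_measurable borel.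
    (\<integral>\<^sup>+z. \<phi> (g \<bullet> z) * ennreal (exp (- (z \<bullet> (J *v z)) / 2)) \<partial>lborel) =
    C * (\<integral>\<^sup>+y. \<phi> y * ennreal (exp (- y\<^sup>2 / (2 * r))) \<partial>lborel)"
proof -
  \<comment> \<open>The weight for averaging over the shift \<open>s\<close>; of its shape only
    total mass 1 matters.\<close>
  define k :: "real \<Rightarrow> ennreal" where "k = indicator {0..1}"
  define E where "E y = ennreal (exp (- y\<^sup>2 / (2 * r)))" for y
  \<comment> \<open>\<open>F\<close> is the Gaussian weight with the factor
    \<open>E (g \<bullet> z)\<close> divided out. Completing the square shows that it is invariant
    under shifts along \<open>v\<close>.\<close>
  define F where "F z = ennreal (exp ((g \<bullet> z)\<^sup>2 / (2 * r) - (z \<bullet> (J *v z)) / 2))" for z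
  have [measurable]: "k \<in> borel_measurable borel" "E \<in> borel_measurable borel" unfolding k_def E_def by auto
  have [measurable]: "(\<lambda>z. J *v z) \<in> borel_measurable borel"
    by (intro borel_measurable_continuous_onI linear_continuous_on matrix_vector_mul_bounded_linear)
  have [measurable]: "F \<in> borel_measurable borel" unfolding F_def by measurable
  have gv: "g \<bullet> (s *\<^sub>R v + z) = g \<bullet> z + s * r" for s z
    by (simp add: inner_add_right r)
  have Fshift: "F (s *\<^sub>R v + z) = F z" for s z
  proof -
    have a: "v \<bullet> (J *v z) = g \<bullet> z" using sym[of v z] v by (simp add: inner_commute)
    have "(s *\<^sub>R v + z) \<bullet> (J *v (s *\<^sub>R v + z)) = z \<bullet> (J *v z) + 2 * s * (g \<bullet> z) + s\<^sup>2 * r"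
      by (simp add: matrix_vector_right_distrib matrix_vector_mult_scaleR inner_add_left
          inner_add_right v a r power2_eq_square inner_commute algebra_simps)
    then show ?thesis
      unfolding F_def gv using r(2) by (simp add: field_simps power2_eq_square)
  qed
  have EF: "E (g \<bullet> z) * F z = ennreal (exp (- (z \<bullet> (J *v z)) / 2))" for z
    unfolding E_def F_def by (simp add: ennreal_mult[symmetric] exp_add[symmetric])
  have k1: "(\<integral>\<^sup>+s. k (s - a) \<partial>lborel) = 1" for a
    using nn_integral_lborel_shift[of k "-a"] unfolding k_def by simp
  define C where "C = (\<integral>\<^sup>+z. F z * k (- (g \<bullet> z) / r) \<partial>lborel) * ennreal (1 / r)"
  show ?thesis
  proof (intro exI ballI)
    fix \<phi> :: "real \<Rightarrow> ennreal" assume [measurable]: "\<phi> \<in> borel_measurable borel"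
    \<comment> \<open>A factor 1 is inserted as the integral of \<open>k\<close> centred at
      \<open>(g \<bullet> z) / r\<close>. After exchanging the integrals, translating
      \<open>z\<close> by \<open>s *\<^sub>R v\<close> for each fixed \<open>s\<close> moves
      \<open>s\<close> out of \<open>k\<close> and into the arguments of \<phi> and
      \<open>E\<close>.\<close>
    have "(\<integral>\<^sup>+z. \<phi> (g \<bullet> z) * ennreal (exp (- (z \<bullet> (J *v z)) / 2)) \<partial>lborel)
      = (\<integral>\<^sup>+z. \<phi> (g \<bullet> z) * E (g \<bullet> z) * F z * (\<integral>\<^sup>+s. k (s - (g \<bullet> z) / r) \<partial>lborel) \<partial>lborel)"
      by (simp add: k1 EF mult.assoc)
    also have "\<dots> = (\<integral>\<^sup>+z. \<integral>\<^sup>+s. \<phi> (g \<bullet> z) * E (g \<bullet> z) * F z * k (s - (g \<bullet> z) / r) \<partial>lborel \<partial>lborel)"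
      by (simp add: nn_integral_cmult)
    also have "\<dots> = (\<integral>\<^sup>+s. \<integral>\<^sup>+z. \<phi> (g \<bullet> z) * E (g \<bullet> z) * F z * k (s - (g \<bullet> z) / r) \<partial>lborel \<partial>lborel)"
      by (rule lborel_pair.Fubini') simp
    also have "\<dots> = (\<integral>\<^sup>+s. \<integral>\<^sup>+z. \<phi> (g \<bullet> z + s * r) * E (g \<bullet> z + s * r) * F z * k (- (g \<bullet> z) / r) \<partial>lborel \<partial>lborel)"
    proof (rule nn_integral_cong)
      fix s
      have k: "k (s - (g \<bullet> z + s * r) / r) = k (- (g \<bullet> z) / r)" for z
        using r(2) by (simp add: add_divide_distrib)
      show "(\<integral>\<^sup>+z. \<phi> (g \<bullet> z) * E (g \<bullet> z) * F z * k (s - (g \<bullet> z) / r) \<partial>lborel) =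
        (\<integral>\<^sup>+z. \<phi> (g \<bullet> z + s * r) * E (g \<bullet> z + s * r) * F z * k (- (g \<bullet> z) / r) \<partial>lborel)"
        by (subst nn_integral_lborel_shift[of _ "s *\<^sub>R v", symmetric]) (simp_all add: gv Fshift k)
    qed
    also have "\<dots> = (\<integral>\<^sup>+z. \<integral>\<^sup>+s. \<phi> (g \<bullet> z + s * r) * E (g \<bullet> z + s * r) * F z * k (- (g \<bullet> z) / r) \<partial>lborel \<partial>lborel)"
      by (rule lborel_pair.Fubini'[symmetric]) simp
    also have "\<dots> = (\<integral>\<^sup>+z. F z * k (- (g \<bullet> z) / r) * (\<integral>\<^sup>+s. \<phi> (g \<bullet> z + r * s) * E (g \<bullet> z + r * s) \<partial>lborel) \<partial>lborel)"
      by (subst nn_integral_cmult[symmetric]) (auto simp: mult_ac)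
    \<comment> \<open>Substituting \<open>y = g \<bullet> z + r * s\<close> over the whole line
      gives an inner integral that no longer depends on \<open>z\<close>, so the double integral
      factors.\<close>
    also have "\<dots> = (\<integral>\<^sup>+z. F z * k (- (g \<bullet> z) / r) * (ennreal (1 / r) * (\<integral>\<^sup>+y. \<phi> y * E y \<partial>lborel)) \<partial>lborel)"
    proof -
      have "ennreal (1 / r) * (\<integral>\<^sup>+y. \<phi> y * E y \<partial>lborel) = (\<integral>\<^sup>+s. \<phi> (t + r * s) * E (t + r * s) \<partial>lborel)" for t
        using r(2) by (subst nn_integral_real_affine[of _ r t])
          (auto simp: mult.assoc[symmetric] ennreal_mult[symmetric])
      then show ?thesis by simp
    qed
    also have "\<dots> = C * (\<integral>\<^sup>+y. \<phi> y * E y \<partial>lborel)"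
      unfolding C_def by (subst nn_integral_multc) (auto simp: mult_ac)
    finally show "(\<integral>\<^sup>+z. \<phi> (g \<bullet> z) * ennreal (exp (- (z \<bullet> (J *v z)) / 2)) \<partial>lborel) =
      C * (\<integral>\<^sup>+y. \<phi> y * ennreal (exp (- y\<^sup>2 / (2 * r))) \<partial>lborel)" unfolding E_def .
  qed
qed

section \<open>Linear functionals of multivariate normal laws\<close>

lemma normal_law_real_distribution: "\<sigma> \<ge> 0 \<Longrightarrow> real_distribution (normal_law \<mu> \<sigma>)"
  unfolding real_distribution_def real_distribution_axioms_def normal_law_def
  using prob_space_normal_density[of \<sigma> \<mu>] by (auto intro: prob_space_return)

lemma sets_mvnormal [simp, measurable_cong]: "sets (mvnormal \<mu> \<Sigma>) = sets borel"
  and space_mvnormal [simp]: "space (mvnormal \<mu> \<Sigma>) = UNIV"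
  by (simp_all add: mvnormal_def)

text \<open>\<open>mvnormal\<close> inverts its covariance in the exponent; with covariance
  \<open>matrix_inv J\<close> the double inverse has to collapse to \<open>J\<close>.\<close>

lemma
  fixes J :: "real^'l^'l"
  assumes "invertible J"
  shows matrix_inv_involutive: "matrix_inv (matrix_inv J) = J"
    and matrix_mul_matrix_inv: "J ** matrix_inv J = mat 1"
proof -
  have *: "A ** matrix_inv A = mat 1 \<and> matrix_inv A ** A = mat 1" if "invertible A" for A :: "real^'l^'l"
    using that unfolding invertible_def matrix_inv_def by (rule someI_ex)
  show "J ** matrix_inv J = mat 1" using *[OF assms] by simp
  have "invertible (matrix_inv J)" using *[OF assms] unfolding invertible_def by blast
  from *[OF this] *[OF assms] show "matrix_inv (matrix_inv J) = J"
    by (metis matrix_mul_assoc matrix_mul_lid matrix_mul_rid)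
qed

text \<open>Disintegrating along \<open>g \<bullet> z\<close>, with \<open>v\<close> the preimage of
  \<open>g\<close> under \<open>J\<close>, shows that the image law is a constant \<open>K\<close>
  times the centred normal law of variance \<open>r\<close>. Both laws have mass one, so
  \<open>K = 1\<close>. Total mass one of \<open>mvnormal\<close> enters as a hypothesis, which
  avoids evaluating its normalising constant.\<close>

lemma distr_mvnormal_inner:
  fixes J :: "real^'l^'l"
  assumes sym: "\<And>u w. u \<bullet> (J *v w) = w \<bullet> (J *v u)"
    and nonneg: "\<And>v. 0 \<le> v \<bullet> (J *v v)" and eq0: "\<And>v. v \<bullet> (J *v v) = 0 \<Longrightarrow> J *v v = 0"
    and J: "invertible J" and prob: "prob_space (mvnormal 0 (matrix_inv J))"
  shows "0 \<le> g \<bullet> (matrix_inv J *v g)"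
    and "distr (mvnormal 0 (matrix_inv J)) borel (\<lambda>z. g \<bullet> z) = normal_law 0 (sqrt (g \<bullet> (matrix_inv J *v g)))"
proof -
  let ?N = "mvnormal 0 (matrix_inv J)"
  interpret N: prob_space ?N by fact
  define v where "v = matrix_inv J *v g"
  have Jv: "J *v v = g" by (simp add: v_def matrix_vector_mul_assoc matrix_mul_matrix_inv[OF J])
  define r where "r = g \<bullet> v"
  have r_eq: "r = v \<bullet> (J *v v)" by (simp add: r_def Jv inner_commute)
  then have "r \<ge> 0" using nonneg by simp
  then show "0 \<le> g \<bullet> (matrix_inv J *v g)" by (simp add: r_def v_def)
  have "distr ?N borel (\<lambda>z. g \<bullet> z) = normal_law 0 (sqrt r)"
  proof (cases "r = 0")
    case True
    \<comment> \<open>Here \<open>v\<close> is a null vector of the quadratic form, hence of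
      \<open>J\<close>. The functional is then zero and its law is the point mass that
      \<open>normal_law\<close> assigns to standard deviation 0.\<close>
    then have "g = 0" using eq0 Jv r_eq by metis
    then show ?thesis
      using True by (auto simp: normal_law_def N.emeasure_space_1[simplified] emeasure_distr indicator_def intro!: measure_eqI)
  next
    case False
    with \<open>r \<ge> 0\<close> have r: "r > 0" by simp
    have [measurable]: "(\<lambda>z. J *v z) \<in> borel_measurable borel"
      by (intro borel_measurable_continuous_onI linear_continuous_on matrix_vector_mul_bounded_linear)
    define c where "c = 1 / sqrt ((2 * pi) ^ CARD('l) * det (matrix_inv J))"
    obtain C where C: "\<And>\<phi>. \<phi> \<in> borel_measurable borel \<Longrightarrow>
      (\<integral>\<^sup>+z. \<phi> (g \<bullet> z) * ennreal (exp (- (z \<bullet> (J *v z)) / 2)) \<partial>lborel) =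
      C * (\<integral>\<^sup>+y. \<phi> y * ennreal (exp (- y\<^sup>2 / (2 * r))) \<partial>lborel)"
      using nn_integral_gaussian_linear[OF sym Jv r_def r] by blast
    define K where "K = ennreal c * C * ennreal (sqrt (2 * pi * r))"
    have em: "emeasure (distr ?N borel (\<lambda>z. g \<bullet> z)) A = K * emeasure (normal_law 0 (sqrt r)) A"
      if A[measurable]: "A \<in> sets borel" for A
    proof -
      have [measurable]: "(\<bullet>) g -` A \<in> sets borel"
        by (rule measurable_sets_borel[OF _ A]) simp
      have "emeasure (distr ?N borel (\<lambda>z. g \<bullet> z)) A =
        (\<integral>\<^sup>+z. ennreal (exp (- (z \<bullet> (J *v z)) / 2) * c) * indicator ((\<bullet>) g -` A) z \<partial>lborel)"
        unfolding c_def by (simp add: emeasure_distr mvnormal_def emeasure_density matrix_inv_involutive[OF J])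
      also have "\<dots> = ennreal c * (\<integral>\<^sup>+z. indicator A (g \<bullet> z) * ennreal (exp (- (z \<bullet> (J *v z)) / 2)) \<partial>lborel)"
        by (subst nn_integral_cmult[symmetric])
           (auto simp: ennreal_mult'' mult_ac indicator_def intro!: nn_integral_cong)
      also have "\<dots> = ennreal c * C * (\<integral>\<^sup>+y. indicator A y * ennreal (exp (- y\<^sup>2 / (2 * r))) \<partial>lborel)"
        by (subst C) (auto simp: mult_ac)
      also have "(\<integral>\<^sup>+y. indicator A y * ennreal (exp (- y\<^sup>2 / (2 * r))) \<partial>lborel) =
         ennreal (sqrt (2 * pi * r)) * (\<integral>\<^sup>+y. ennreal (normal_density 0 (sqrt r) y) * indicator A y \<partial>lborel)"
        using r by (subst nn_integral_cmult[symmetric])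
           (auto simp: normal_density_def ennreal_mult[symmetric] indicator_def intro!: nn_integral_cong)
      also have "(\<integral>\<^sup>+y. ennreal (normal_density 0 (sqrt r) y) * indicator A y \<partial>lborel) =
         emeasure (normal_law 0 (sqrt r)) A"
        using r by (simp add: normal_law_def emeasure_density)
      finally show ?thesis by (simp add: K_def mult.assoc)
    qed
    have "emeasure (distr ?N borel (\<lambda>z. g \<bullet> z)) UNIV = 1"
      using N.emeasure_space_1 by (simp add: emeasure_distr)
    moreover have "emeasure (normal_law 0 (sqrt r)) UNIV = 1"
      using normal_law_real_distribution[of "sqrt r" 0] r
      by (metis real_distribution.space_eq_univ prob_space.emeasure_space_1 real_distribution.axioms(1) real_sqrt_ge_zero less_imp_le)
    ultimately have "K = 1" using em[of UNIV] by simp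
    with em show ?thesis
      by (intro measure_eqI) (auto simp: normal_law_def)
  qed
  then show "distr ?N borel (\<lambda>z. g \<bullet> z) = normal_law 0 (sqrt (g \<bullet> (matrix_inv J *v g)))"
    by (simp add: r_def v_def)
qed

text \<open>The random centre acts only by translation, so one centred law serves for all samples
  and all \<open>n\<close>.\<close>

lemma mvnormal_eq_distr:
  fixes \<Sigma> :: "real^'l^'l"
  shows "mvnormal \<mu> \<Sigma> = distr (mvnormal 0 \<Sigma>) borel ((+) \<mu>)"
proof (rule measure_eqI)
  fix A :: "(real^'l) set" assume "A \<in> sets (mvnormal \<mu> \<Sigma>)"
  then have [measurable]: "A \<in> sets borel" by simp
  have [measurable]: "(\<lambda>z. B *v z) \<in> borel_measurable borel" for B :: "real^'l^'l"
    by (intro borel_measurable_continuous_onI linear_continuous_on matrix_vector_mul_bounded_linear)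
  have [measurable]: "(+) \<mu> -` A \<in> sets borel"
    by (rule measurable_sets_borel[of _ borel]) simp_all
  show "emeasure (mvnormal \<mu> \<Sigma>) A = emeasure (distr (mvnormal 0 \<Sigma>) borel ((+) \<mu>)) A"
    apply (simp add: emeasure_distr)
    apply (simp add: mvnormal_def emeasure_density)
    apply (subst nn_integral_lborel_shift[of _ \<mu>, symmetric])
    apply (auto simp: indicator_def intro!: nn_integral_cong)
    done
qed simp

section \<open>Scaling, distribution function and quantiles of univariate normal laws\<close>

lemma normal_law_standardize:
  assumes "\<sigma> \<ge> 0"
  shows "normal_law \<mu> \<sigma> = distr (normal_law 0 1) borel (\<lambda>u. \<mu> + \<sigma> * u)"
proof (cases "\<sigma> = 0")
  case True
  interpret real_distribution "normal_law 0 1" by (rule normal_law_real_distribution) simp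
  show ?thesis
    using True emeasure_space_1 by (intro measure_eqI) (auto simp: normal_law_def[of \<mu>] emeasure_distr indicator_def)
next
  case False
  with assms have \<sigma>: "\<sigma> > 0" by simp
  show ?thesis
  proof (rule measure_eqI)
    fix A assume "A \<in> sets (normal_law \<mu> \<sigma>)"
    then have A[measurable]: "A \<in> sets borel" by (simp add: normal_law_def split: if_splits)
    have [measurable]: "(\<lambda>u. \<mu> + \<sigma> * u) -` A \<in> sets borel" by (rule measurable_sets_borel[OF _ A]) simp
    have nd: "\<sigma> * normal_density \<mu> \<sigma> (\<mu> + \<sigma> * u) = normal_density 0 1 u" for u
      using \<sigma> by (simp add: normal_density_def real_sqrt_mult power_mult_distrib)
    have "emeasure (normal_law \<mu> \<sigma>) A = (\<integral>\<^sup>+y. ennreal (normal_density \<mu> \<sigma> y) * indicator A y \<partial>lborel)"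
      using \<sigma> by (simp add: normal_law_def emeasure_density)
    also have "\<dots> = (\<integral>\<^sup>+u. ennreal \<sigma> * (ennreal (normal_density \<mu> \<sigma> (\<mu> + \<sigma> * u)) * indicator A (\<mu> + \<sigma> * u)) \<partial>lborel)"
      using \<sigma> by (subst nn_integral_real_affine[where c = \<sigma> and t = \<mu>]) (auto simp: nn_integral_cmult)
    also have "\<dots> = (\<integral>\<^sup>+u. ennreal (normal_density 0 1 u) * indicator ((\<lambda>u. \<mu> + \<sigma> * u) -` A) u \<partial>lborel)"
      using \<sigma> by (intro nn_integral_cong) (simp add: mult.assoc[symmetric] ennreal_mult[symmetric] nd indicator_def)
    also have "\<dots> = emeasure (distr (normal_law 0 1) borel (\<lambda>u. \<mu> + \<sigma> * u)) A"
      by (simp add: emeasure_distr normal_law_def emeasure_density)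
    finally show "emeasure (normal_law \<mu> \<sigma>) A = emeasure (distr (normal_law 0 1) borel (\<lambda>u. \<mu> + \<sigma> * u)) A" .
  qed (use \<sigma> in \<open>simp add: normal_law_def\<close>)
qed

text \<open>A positive density gives mass zero to no nondegenerate interval, since such an interval
  would have to be Lebesgue null.\<close>

lemma std_normal_cdf_strict_mono: "strict_mono std_normal_cdf"
proof (rule strict_monoI)
  interpret W: real_distribution "normal_law 0 1" by (rule normal_law_real_distribution) simp
  fix x y :: real assume xy: "x < y"
  have "W.prob {x<..y} \<noteq> 0"
  proof
    assume "W.prob {x<..y} = 0"
    then have "emeasure (density lborel (\<lambda>z. ennreal (normal_density 0 1 z))) {x<..y} = 0"
      using W.emeasure_eq_measure[of "{x<..y}"] by (simp add: normal_law_def)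
    then have "{x<..y} \<in> null_sets (density lborel (\<lambda>z. ennreal (normal_density 0 1 z)))"
      by (auto simp: null_sets_def)
    then have "AE z in lborel. z \<in> {x<..y} \<longrightarrow> ennreal (normal_density 0 1 z) = 0"
      by (subst (asm) null_sets_density_iff) auto
    then have "AE z in lborel. z \<notin> {x<..y}"
    proof eventually_elim
      case (elim z)
      then show ?case using normal_density_pos[of 1 0 z] by (auto simp: ennreal_eq_0_iff)
    qed
    then have "{x<..y} \<in> null_sets lborel"
      by (subst AE_iff_null_sets) auto
    then show False using xy by (simp add: null_sets_def)
  qed
  then have "W.prob {x<..y} > 0" by (simp add: zero_less_measure_iff)
  then show "std_normal_cdf x < std_normal_cdf y"
    using W.cdf_diff_eq[OF xy] by (simp add: std_normal_cdf_def)
qed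

text \<open>\<open>inv\<close> inverts only on the range, so the point is that \<alpha> is attained:
  absence of atoms gives continuity, the limits at both ends bracket \<alpha>, and the intermediate
  value theorem applies.\<close>

lemma std_normal_cdf_inv:
  assumes "0 < \<alpha>" "\<alpha> < 1"
  shows "std_normal_cdf (inv std_normal_cdf \<alpha>) = \<alpha>"
proof (rule f_inv_into_f)
  interpret W: real_distribution "normal_law 0 1" by (rule normal_law_real_distribution) simp
  have "W.prob {x} = 0" for x
    by (simp add: normal_law_def measure_def emeasure_density nn_integral_0_iff_AE)
  then have cont: "isCont std_normal_cdf x" for x
    unfolding std_normal_cdf_def by (simp add: W.isCont_cdf)
  obtain l where l: "std_normal_cdf l < \<alpha>"
    using order_tendstoD(2)[OF W.cdf_lim_at_bot assms(1)]
    by (auto simp: std_normal_cdf_def eventually_at_bot_linorder)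
  obtain u where u: "\<alpha> < std_normal_cdf u"
    using order_tendstoD(1)[OF W.cdf_lim_at_top_prob assms(2)]
    by (auto simp: std_normal_cdf_def eventually_at_top_linorder)
  have "l \<le> u" using l u std_normal_cdf_strict_mono
    by (metis less_trans less_asym linorder_le_less_linear strict_monoD)
  then obtain x where "std_normal_cdf x = \<alpha>"
    using IVT[of std_normal_cdf l \<alpha> u] l u cont by auto
  then show "\<alpha> \<in> range std_normal_cdf" by blast
qed

text \<open>The strict inequalities leave a margin that later absorbs the approximation errors. For
  positive \<sigma> they come from strict monotonicity. For \<sigma> = 0 all mass sits at 0, which
  lies strictly between \<open>- h\<close> and \<open>h\<close>.\<close>

lemma normal_law_quantile:
  assumes \<alpha>: "0 < \<alpha>" "\<alpha> < 1" and \<sigma>: "\<sigma> \<ge> 0" and h: "h > 0"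
  shows "\<alpha> < measure (normal_law 0 \<sigma>) {..\<sigma> * inv std_normal_cdf \<alpha> + h}"
    and "measure (normal_law 0 \<sigma>) {..\<sigma> * inv std_normal_cdf \<alpha> - h} < \<alpha>"
proof -
  define q where "q = inv std_normal_cdf \<alpha>"
  interpret W: real_distribution "normal_law 0 1" by (rule normal_law_real_distribution) simp
  have *: "measure (normal_law 0 \<sigma>) {..t} = W.prob {u. \<sigma> * u \<le> t}" for t
    by (subst normal_law_standardize[OF \<sigma>], subst measure_distr) (auto simp: vimage_def)
  have **: "W.prob {u. \<sigma> * u \<le> t} = std_normal_cdf (t / \<sigma>)" if "\<sigma> > 0" for t
  proof -
    have "{u. \<sigma> * u \<le> t} = {..t / \<sigma>}" using that by (auto simp: field_simps)
    then show ?thesis by (simp add: std_normal_cdf_def cdf_def)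
  qed
  have q: "std_normal_cdf q = \<alpha>" unfolding q_def by (rule std_normal_cdf_inv[OF \<alpha>])
  have "\<alpha> < measure (normal_law 0 \<sigma>) {..\<sigma> * q + h} \<and> measure (normal_law 0 \<sigma>) {..\<sigma> * q - h} < \<alpha>"
  proof (cases "\<sigma> = 0")
    case True
    then show ?thesis unfolding * using \<alpha> h W.prob_space by (simp add: not_le)
  next
    case False
    with \<sigma> have s: "\<sigma> > 0" by simp
    have "q < (\<sigma> * q + h) / \<sigma>" "(\<sigma> * q - h) / \<sigma> < q" using s h by (auto simp: field_simps)
    then show ?thesis unfolding * **[OF s]
      using std_normal_cdf_strict_mono q by (metis strict_monoD)
  qed
  then show "\<alpha> < measure (normal_law 0 \<sigma>) {..\<sigma> * inv std_normal_cdf \<alpha> + h}"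
    "measure (normal_law 0 \<sigma>) {..\<sigma> * inv std_normal_cdf \<alpha> - h} < \<alpha>" by (simp_all add: q_def)
qed

section \<open>Value at risk under the posterior, and its measurability in the sample\<close>

lemma VaR_le_iff:
  assumes "prob_space Q" and H: "H \<in> borel_measurable Q" and \<alpha>: "0 < \<alpha>" "\<alpha> < 1"
  shows "VaR \<alpha> Q H \<le> t \<longleftrightarrow> \<alpha> \<le> measure Q {\<theta> \<in> space Q. H \<theta> \<le> t}"
proof -
  interpret prob_space Q by fact
  interpret D: cdf_distribution "distr Q borel H"
    unfolding cdf_distribution_def using H by simp
  have "cdf (distr Q borel H) t = measure Q {\<theta> \<in> space Q. H \<theta> \<le> t}" for t
    unfolding cdf_def using H by (subst measure_distr) (auto intro!: arg_cong[where f = prob])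
  \<comment> \<open>This is the Galois property of the generalised inverse of a distribution
    function: right continuity makes the infimum attained, and \<open>0 < \<alpha> < 1\<close> makes
    the set nonempty and bounded below.\<close>
  then show ?thesis using D.pseudoinverse[OF \<alpha>, of t] by (simp add: VaR_def)
qed

text \<open>The total mass is the normalising constant divided by itself. In \<open>ennreal\<close>
  this quotient is 0 when the constant is 0 or infinite, and 1 otherwise.\<close>

lemma posterior_prob_or_null:
  assumes "(\<lambda>\<theta>. p n \<theta> (restrict \<omega> {..<n})) \<in> borel_measurable \<pi>"
  shows "prob_space (posterior \<pi> p n \<omega>) \<or> (\<forall>A. emeasure (posterior \<pi> p n \<omega>) A = 0)"
proof -
  let ?Q = "posterior \<pi> p n \<omega>"
  let ?c = "\<integral>\<^sup>+\<theta>. ennreal (p n \<theta> (restrict \<omega> {..<n})) \<partial>\<pi>"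
  have sp: "space ?Q = space \<pi>" by (simp add: posterior_def)
  have "(\<integral>\<^sup>+\<theta>. ennreal (p n \<theta> (restrict \<omega> {..<n})) * indicator (space \<pi>) \<theta> \<partial>\<pi>) = ?c"
    by (intro nn_integral_cong) simp
  then have e: "emeasure ?Q (space ?Q) = ?c / ?c"
    using emeasure_posterior[where p = p, OF assms sets.top] sp by simp
  consider "?c = 0 \<or> ?c = \<top>" | "?c \<noteq> 0" "?c < \<top>" using top.not_eq_extremum by blast
  then show ?thesis
  proof cases
    case 1
    then have "emeasure ?Q (space ?Q) = 0" using e by (auto simp: ennreal_top_divide divide_ennreal_def)
    then show ?thesis using emeasure_space[of ?Q] by (metis le_zero_eq)
  next
    case 2
    then show ?thesis using e by (auto intro!: prob_spaceI simp: ennreal_divide_self)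
  qed
qed

text \<open>Sublevel sets of the value at risk are conditions on the posterior mass of a fixed set,
  and this mass is measurable in the sample because the density is jointly measurable.\<close>

lemma borel_measurable_VaR_posterior:
  fixes \<Xi> :: "'b::topological_space set"
  assumes "prob_space \<pi>" and [measurable]: "H \<in> borel_measurable \<pi>"
    and p: "(\<lambda>(\<theta>, y). p n \<theta> y) \<in> borel_measurable (\<pi> \<Otimes>\<^sub>M sample_space n \<Xi>)"
    and M: "sets M = sets (sequence_space \<Xi>)" and \<alpha>: "0 < \<alpha>" "\<alpha> < 1"
  shows "(\<lambda>\<omega>. VaR \<alpha> (posterior \<pi> p n \<omega>) H) \<in> borel_measurable M"
proof -
  interpret \<pi>: prob_space \<pi> by fact
  note [measurable_cong] = M
  have r[measurable]: "(\<lambda>\<omega>. restrict \<omega> {..<n}) \<in> measurable M (sample_space n \<Xi>)"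
    unfolding measurable_cong_sets[OF M refl] by (rule measurable_restrict_subset) simp
  have j: "(\<lambda>(\<omega>, \<theta>). p n \<theta> (restrict \<omega> {..<n})) \<in> borel_measurable (M \<Otimes>\<^sub>M \<pi>)"
  proof -
    have "(\<lambda>(\<omega>, \<theta>). (\<theta>, restrict \<omega> {..<n})) \<in> measurable (M \<Otimes>\<^sub>M \<pi>) (\<pi> \<Otimes>\<^sub>M sample_space n \<Xi>)"
      by measurable
    from measurable_compose[OF this p] show ?thesis by (simp add: case_prod_unfold)
  qed
  note [measurable] = j
  have sec: "(\<lambda>\<theta>. p n \<theta> (restrict \<omega> {..<n})) \<in> borel_measurable \<pi>" if "\<omega> \<in> space M" for \<omega>
    using measurable_Pair2[OF j that] by simp
  have em[measurable]: "(\<lambda>\<omega>. emeasure (posterior \<pi> p n \<omega>) A) \<in> borel_measurable M"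
    if [measurable]: "A \<in> sets \<pi>" for A
  proof -
    have "(\<lambda>\<omega>. (\<integral>\<^sup>+\<theta>\<in>A. ennreal (p n \<theta> (restrict \<omega> {..<n})) \<partial>\<pi>) /
       (\<integral>\<^sup>+\<theta>. ennreal (p n \<theta> (restrict \<omega> {..<n})) \<partial>\<pi>)) \<in> borel_measurable M"
      by measurable
    then show ?thesis
      by (rule measurable_cong[THEN iffD1, rotated]) (simp add: emeasure_posterior[where p = p, OF sec that])
  qed
  have sp: "space (posterior \<pi> p n \<omega>) = space \<pi>" for \<omega> by (simp add: posterior_def)
  show ?thesis
  proof (subst borel_measurable_iff_le, rule allI)
    fix t
    define A where "A = {\<theta> \<in> space \<pi>. H \<theta> \<le> t}"
    have [measurable]: "A \<in> sets \<pi>" unfolding A_def by measurable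
    \<comment> \<open>Where the posterior is the zero measure no threshold reaches \<alpha>, so the
      value at risk is the unspecified real \<open>Inf {}\<close>. As it is the same for all such
      samples, measurability survives.\<close>
    have "{\<omega> \<in> space M. VaR \<alpha> (posterior \<pi> p n \<omega>) H \<le> t} =
      {\<omega> \<in> space M. if emeasure (posterior \<pi> p n \<omega>) (space \<pi>) = 1
         then \<alpha> \<le> enn2real (emeasure (posterior \<pi> p n \<omega>) A) else Inf ({} :: real set) \<le> t}"
    proof (intro Collect_cong conj_cong refl)
      fix \<omega> assume \<omega>: "\<omega> \<in> space M"
      let ?Q = "posterior \<pi> p n \<omega>"
      from posterior_prob_or_null[where p = p, OF sec[OF \<omega>]]
      show "VaR \<alpha> ?Q H \<le> t \<longleftrightarrow> (if emeasure ?Q (space \<pi>) = 1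
         then \<alpha> \<le> enn2real (emeasure ?Q A) else Inf ({} :: real set) \<le> t)"
      proof
        assume Q: "prob_space ?Q"
        have "H \<in> borel_measurable ?Q" by (simp add: posterior_def)
        from VaR_le_iff[OF Q this \<alpha>, of t] show ?thesis
          using prob_space.emeasure_space_1[OF Q] by (simp add: sp A_def measure_def)
      next
        assume "\<forall>A. emeasure ?Q A = 0"
        then show ?thesis using \<alpha> by (simp add: VaR_def measure_def)
      qed
    qed
    also have "\<dots> \<in> sets M" by measurable
    finally show "{\<omega> \<in> space M. VaR \<alpha> (posterior \<pi> p n \<omega>) H \<le> t} \<in> sets M" .
  qed
qed

text \<open>Measurable dependence of the infinite product laws on the parameter passes to one
  observation, so \<open>P\<close> is a kernel and integrals against it are measurable.\<close>

lemma borel_measurable_expected_cost: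
  fixes \<Xi> :: "'b::topological_space set"
  assumes model: "\<And>\<theta>. \<theta> \<in> \<Theta> \<Longrightarrow> prob_space (P \<theta>)"
      "\<And>\<theta>. \<theta> \<in> \<Theta> \<Longrightarrow> sets (P \<theta>) = sets (borel_on \<Xi>)"
    and kernel: "\<And>B. B \<in> sets (sequence_space \<Xi>) \<Longrightarrow>
      (\<lambda>\<theta>. measure (sequence_law (P \<theta>)) B) \<in> borel_measurable (borel_on \<Theta>)"
    and ne: "\<theta>c \<in> \<Theta>" and int: "integrable (P \<theta>c) (h x)"
  shows "expected_cost P h x \<in> borel_measurable (borel_on \<Theta>)"
proof -
  have "P \<in> measurable (borel_on \<Theta>) (subprob_algebra (borel_on \<Xi>))"
  proof (rule measurable_subprob_algebra)
    fix A assume A: "A \<in> sets (borel_on \<Xi>)"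
    \<comment> \<open>The cylinder over \<open>A\<close> in coordinate 0: its mass under the product
      law is the mass of \<open>A\<close> under \<open>P \<theta>\<close>.\<close>
    define B where "B = (\<lambda>\<omega>. \<omega> 0) -` A \<inter> space (sequence_space \<Xi>)"
    have B: "B \<in> sets (sequence_space \<Xi>)"
      unfolding B_def by (rule measurable_sets[OF _ A]) (rule measurable_component_singleton, simp)
    have "emeasure (P \<theta>) A = ennreal (measure (sequence_law (P \<theta>)) B)" if \<theta>: "\<theta> \<in> \<Theta>" for \<theta>
    proof -
      interpret S: prob_space "sequence_law (P \<theta>)" by (rule prob_space_PiM) (rule model(1)[OF \<theta>])
      have sp: "space (sequence_law (P \<theta>)) = space (sequence_space \<Xi>)"
        by (rule sets_eq_imp_space_eq, rule sets_PiM_cong) (simp_all add: model(2)[OF \<theta>])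
      have "P \<theta> = distr (sequence_law (P \<theta>)) (P \<theta>) (\<lambda>\<omega>. \<omega> 0)"
        by (rule distr_PiM_component[symmetric]) (simp_all add: model(1)[OF \<theta>])
      then have "emeasure (P \<theta>) A = emeasure (distr (sequence_law (P \<theta>)) (P \<theta>) (\<lambda>\<omega>. \<omega> 0)) A"
        by simp
      also have "\<dots> = emeasure (sequence_law (P \<theta>)) B"
        unfolding B_def sp[symmetric]
        by (rule emeasure_distr) (simp_all add: model(2)[OF \<theta>] A)
      finally show ?thesis by (simp add: S.emeasure_eq_measure)
    qed
    then show "(\<lambda>\<theta>. emeasure (P \<theta>) A) \<in> borel_measurable (borel_on \<Theta>)"
      using kernel[OF B] by (subst measurable_cong[where g = "\<lambda>\<theta>. ennreal (measure (sequence_law (P \<theta>)) B)"])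
        (auto simp: space_restrict_space)
  qed (auto simp: space_restrict_space model prob_space_imp_subprob_space)
  moreover have "h x \<in> borel_measurable (borel_on \<Xi>)"
    using borel_measurable_integrable[OF int] unfolding measurable_cong_sets[OF model(2)[OF ne] refl] .
  ultimately show ?thesis
    unfolding expected_cost_def[abs_def]
    by (rule measurable_compose[OF _ integral_measurable_subprob_algebra])
qed

section \<open>Tightness, linearisation of distribution functions and Slutsky's lemma\<close>

lemma prob_tail_bound:
  fixes N :: "'a::real_normed_vector measure"
  assumes "prob_space N" and sets: "sets N = sets borel" and "\<kappa> > 0"
  shows "\<exists>K>0. measure N {z. norm z > K} < \<kappa>"
proof -
  interpret N: prob_space N by fact
  note [measurable_cong] = sets
  have sp: "space N = UNIV" using sets_eq_imp_space_eq[OF sets] by simp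
  interpret D: real_distribution "distr N borel norm" by simp
  have "\<forall>\<^sub>F K in at_top. 1 - \<kappa> < cdf (distr N borel norm) K"
    using order_tendstoD(1)[OF D.cdf_lim_at_top_prob] \<open>\<kappa> > 0\<close> by simp
  then have "\<forall>\<^sub>F K in at_top. 1 - \<kappa> < cdf (distr N borel norm) K \<and> K > 0"
    using eventually_gt_at_top[of "0::real"] by (rule eventually_conj)
  then obtain K where K: "1 - \<kappa> < cdf (distr N borel norm) K" "K > 0"
    using eventually_happens'[OF trivial_limit_at_top_linorder] by blast
  have "cdf (distr N borel norm) K = N.prob {z. norm z \<le> K}"
    unfolding cdf_def by (subst measure_distr) (auto simp: sp intro!: arg_cong[where f = N.prob])
  moreover have "N.prob {z. norm z > K} = 1 - N.prob {z. norm z \<le> K}"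
    using N.prob_compl[of "{z. norm z \<le> K}"] by (simp add: sp sets Compl_eq_Diff_UNIV[symmetric] Collect_neg_eq[symmetric] not_le)
  ultimately show ?thesis using K by (intro exI[of _ K]) simp
qed

text \<open>Weak convergence tests only continuous functions, so the tail indicator is replaced by a
  ramp. The ramp lies below the indicator at radius \<open>K\<close> and above the one at radius
  \<open>K + 1\<close>, hence the radius in the conclusion.\<close>

lemma weak_conv_vec_tight:
  fixes \<mu> :: "nat \<Rightarrow> 'a::euclidean_space measure"
  assumes conv: "weak_conv_vec \<mu> N" and N: "prob_space N" "sets N = sets borel" and "\<kappa> > 0"
    and \<mu>: "\<forall>\<^sub>F n in sequentially. prob_space (\<mu> n)" "\<And>n. sets (\<mu> n) = sets borel"
  shows "\<exists>K>0. \<forall>\<^sub>F n in sequentially. measure (\<mu> n) {z. norm z > K} < \<kappa>"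
proof -
  interpret N: prob_space N by fact
  note [measurable_cong] = N(2)
  have sp: "space N = UNIV" using sets_eq_imp_space_eq[OF N(2)] by simp
  obtain K where K: "K > 0" "measure N {z. norm z > K} < \<kappa>"
    using prob_tail_bound[OF N \<open>\<kappa> > 0\<close>] by blast
  define f :: "'a \<Rightarrow> real" where "f z = min 1 (max 0 (norm z - K))" for z
  have f: "continuous_on UNIV f" unfolding f_def by (intro continuous_intros)
  have f01: "0 \<le> f z" "f z \<le> 1" for z by (auto simp: f_def)
  have bdd: "bounded (range f)" using f01 by (auto simp: bounded_iff intro!: exI[of _ 1])
  have [measurable]: "f \<in> borel_measurable borel" by (rule borel_measurable_continuous_onI[OF f])
  have "(\<integral>z. f z \<partial>N) \<le> (\<integral>z. indicator {z. norm z > K} z \<partial>N)"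
  proof (rule integral_mono)
    show "integrable N f" by (rule N.integrable_const_bound[of _ 1]) (use f01 in auto)
    show "integrable N (indicator {z. norm z > K} :: 'a \<Rightarrow> real)"
      by (rule N.integrable_const_bound[of _ 1]) auto
  qed (auto simp: f_def indicator_def)
  also have "\<dots> < \<kappa>" using K by (simp add: sp)
  finally have "\<forall>\<^sub>F n in sequentially. (\<integral>z. f z \<partial>\<mu> n) < \<kappa>"
    using conv f bdd unfolding weak_conv_vec_def by (metis order_tendstoD(2))
  with \<mu>(1) have "\<forall>\<^sub>F n in sequentially. measure (\<mu> n) {z. norm z > K + 1} < \<kappa>"
  proof eventually_elim
    case (elim n)
    interpret \<mu>: prob_space "\<mu> n" by fact
    note [measurable_cong] = \<mu>(2)[of n]
    have sp: "space (\<mu> n) = UNIV" using sets_eq_imp_space_eq[OF \<mu>(2)] by simp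
    have "measure (\<mu> n) {z. norm z > K + 1} = (\<integral>z. indicator {z. norm z > K + 1} z \<partial>\<mu> n)"
      by (simp add: sp)
    also have "\<dots> \<le> (\<integral>z. f z \<partial>\<mu> n)"
    proof (rule integral_mono)
      show "integrable (\<mu> n) f" by (rule \<mu>.integrable_const_bound[of _ 1]) (use f01 in auto)
      show "integrable (\<mu> n) (indicator {z. norm z > K + 1} :: 'a \<Rightarrow> real)"
        by (rule \<mu>.integrable_const_bound[of _ 1]) auto
    qed (auto simp: f_def indicator_def)
    finally show ?case using elim by simp
  qed
  then show ?thesis using K(1) by (intro exI[of _ "K + 1"]) auto
qed

text \<open>Replacing \<open>Y\<close> by \<open>g \<bullet> Z\<close> costs \<eta> in the
  threshold, off the event that \<open>Z\<close> has norm above \<open>K\<close>. That event has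
  probability at most \<open>2 * \<tau>\<close>: one \<tau> for passing to the normal law, one for
  the normal tail. The third \<tau> is the price of exchanging the laws on the half-space.\<close>

lemma linearised_cdf_bounds:
  fixes g \<Delta> :: "'a::euclidean_space"
  assumes "prob_space Q" and [measurable]: "Y \<in> borel_measurable Q" "Z \<in> borel_measurable Q"
    and "prob_space N" and sets: "sets N = sets borel"
    and TV: "\<And>A. A \<in> sets borel \<Longrightarrow>
      \<bar>measure (distr Q borel Z) A - measure (distr N borel ((+) \<Delta>)) A\<bar> \<le> \<tau>"
    and R: "\<And>\<theta>. \<theta> \<in> space Q \<Longrightarrow> norm (Z \<theta>) \<le> K \<Longrightarrow> \<bar>Y \<theta> - g \<bullet> Z \<theta>\<bar> \<le> \<eta>"
    and \<Delta>: "norm \<Delta> \<le> K / 2" and tail: "measure N {z. norm z > K / 2} \<le> \<tau>"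
  shows "measure N {z. g \<bullet> z \<le> a + \<eta>} - 3 * \<tau> \<le> measure Q {\<theta> \<in> space Q. Y \<theta> \<le> g \<bullet> \<Delta> + a + 2 * \<eta>}"
    and "measure Q {\<theta> \<in> space Q. Y \<theta> \<le> g \<bullet> \<Delta> + a - 2 * \<eta>} \<le> measure N {z. g \<bullet> z \<le> a - \<eta>} + 3 * \<tau>"
proof -
  interpret Q: prob_space Q by fact
  interpret N: prob_space N by fact
  note [measurable_cong] = sets
  have sp: "space N = UNIV" using sets_eq_imp_space_eq[OF sets] by simp
  have TV': "\<bar>Q.prob {\<theta> \<in> space Q. Z \<theta> \<in> A} - N.prob {z. \<Delta> + z \<in> A}\<bar> \<le> \<tau>" if "A \<in> sets borel" for A
    using TV[OF that] that by (simp add: measure_distr vimage_def Int_def sp conj_commute)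
  have half: "\<bar>Q.prob {\<theta> \<in> space Q. g \<bullet> Z \<theta> \<le> g \<bullet> \<Delta> + t} - N.prob {z. g \<bullet> z \<le> t}\<bar> \<le> \<tau>" for t
    using TV'[of "{z. g \<bullet> z \<le> g \<bullet> \<Delta> + t}"] by (simp add: inner_add_right)
  have "{z. norm (\<Delta> + z) > K} \<subseteq> {z. norm z > K / 2}"
  proof safe
    fix z assume "K < norm (\<Delta> + z)"
    with norm_triangle_ineq[of \<Delta> z] \<Delta> show "K / 2 < norm z" by linarith
  qed
  then have "N.prob {z. norm (\<Delta> + z) > K} \<le> N.prob {z. norm z > K / 2}"
    by (intro N.finite_measure_mono) auto
  then have tailQ: "Q.prob {\<theta> \<in> space Q. norm (Z \<theta>) > K} \<le> 2 * \<tau>"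
    using TV'[of "{z. norm z > K}"] tail by simp
  have "Q.prob {\<theta> \<in> space Q. g \<bullet> Z \<theta> \<le> g \<bullet> \<Delta> + (a + \<eta>)} \<le>
      Q.prob ({\<theta> \<in> space Q. Y \<theta> \<le> g \<bullet> \<Delta> + a + 2 * \<eta>} \<union> {\<theta> \<in> space Q. norm (Z \<theta>) > K})"
    using R by (intro Q.finite_measure_mono) (fastforce simp: not_less, measurable)
  also have "\<dots> \<le> Q.prob {\<theta> \<in> space Q. Y \<theta> \<le> g \<bullet> \<Delta> + a + 2 * \<eta>} + Q.prob {\<theta> \<in> space Q. norm (Z \<theta>) > K}"
    by (rule measure_Un_le) measurable
  finally show "N.prob {z. g \<bullet> z \<le> a + \<eta>} - 3 * \<tau> \<le> Q.prob {\<theta> \<in> space Q. Y \<theta> \<le> g \<bullet> \<Delta> + a + 2 * \<eta>}"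
    using half[of "a + \<eta>"] tailQ by linarith
  have "Q.prob {\<theta> \<in> space Q. Y \<theta> \<le> g \<bullet> \<Delta> + a - 2 * \<eta>} \<le>
      Q.prob ({\<theta> \<in> space Q. g \<bullet> Z \<theta> \<le> g \<bullet> \<Delta> + (a - \<eta>)} \<union> {\<theta> \<in> space Q. norm (Z \<theta>) > K})"
    using R by (intro Q.finite_measure_mono) (fastforce simp: not_less, measurable)
  also have "\<dots> \<le> Q.prob {\<theta> \<in> space Q. g \<bullet> Z \<theta> \<le> g \<bullet> \<Delta> + (a - \<eta>)} + Q.prob {\<theta> \<in> space Q. norm (Z \<theta>) > K}"
    by (rule measure_Un_le) measurable
  finally show "Q.prob {\<theta> \<in> space Q. Y \<theta> \<le> g \<bullet> \<Delta> + a - 2 * \<eta>} \<le> N.prob {z. g \<bullet> z \<le> a - \<eta>} + 3 * \<tau>"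
    using half[of "a - \<eta>"] tailQ by linarith
qed

text \<open>The functions \<open>cts_step\<close> suffice for weak convergence and are uniformly
  continuous with values in the unit interval. Expectations of such a function at \<open>V n\<close>
  and \<open>U n\<close> thus differ by at most \<open>e / 2\<close> plus the probability that the
  two are far apart. For \<open>U\<close> only eventual measurability is asked, since the centring
  is measurable only from \<open>n = 1\<close> on.\<close>

lemma (in prob_space) slutsky_weak_conv_m:
  fixes U V :: "nat \<Rightarrow> 'a \<Rightarrow> real"
  assumes V[measurable]: "\<And>n. V n \<in> borel_measurable M"
    and U: "\<forall>\<^sub>F n in sequentially. U n \<in> borel_measurable M"
    and L: "real_distribution L"
    and diff: "\<And>\<eta>. \<eta> > 0 \<Longrightarrow> (\<lambda>n. prob {\<omega> \<in> space M. \<eta> < \<bar>V n \<omega> - U n \<omega>\<bar>}) \<longlonglongrightarrow> 0"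
    and conv: "\<And>x y. x < y \<Longrightarrow> (\<lambda>n. expectation (\<lambda>\<omega>. cts_step x y (U n \<omega>))) \<longlonglongrightarrow> integral\<^sup>L L (cts_step x y)"
  shows "weak_conv_m (\<lambda>n. distr M borel (V n)) L"
proof (rule integral_cts_step_conv_imp_weak_conv[OF _ L])
  fix x y :: real assume xy: "x < y"
  let ?f = "cts_step x y"
  have f01: "0 \<le> ?f z" "?f z \<le> 1" for z using xy by (auto simp: cts_step_def)
  have [measurable]: "?f \<in> borel_measurable borel"
    by (intro borel_measurable_continuous_onI uniformly_continuous_imp_continuous cts_step_uniformly_continuous xy)
  have "(\<lambda>n. expectation (\<lambda>\<omega>. ?f (V n \<omega>)) - expectation (\<lambda>\<omega>. ?f (U n \<omega>))) \<longlonglongrightarrow> 0"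
  proof (rule LIMSEQ_I)
    fix e :: real assume e: "e > 0"
    obtain d where d: "d > 0" "\<And>u v. dist v u < d \<Longrightarrow> dist (?f v) (?f u) < e / 2"
      using cts_step_uniformly_continuous[OF xy] e unfolding uniformly_continuous_on_def
      by (metis UNIV_I half_gt_zero)
    have "\<forall>\<^sub>F n in sequentially. prob {\<omega> \<in> space M. d / 2 < \<bar>V n \<omega> - U n \<omega>\<bar>} < e / 2"
      using order_tendstoD(2)[OF diff[of "d / 2"], of "e / 2"] d(1) e by simp
    with U have "\<forall>\<^sub>F n in sequentially. norm (expectation (\<lambda>\<omega>. ?f (V n \<omega>)) - expectation (\<lambda>\<omega>. ?f (U n \<omega>)) - 0) < e"
    proof eventually_elim
      case (elim n)
      note [measurable] = elim(1)
      let ?B = "{\<omega> \<in> space M. d / 2 < \<bar>V n \<omega> - U n \<omega>\<bar>}"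
      have i1: "integrable M (\<lambda>\<omega>. ?f (V n \<omega>))" "integrable M (\<lambda>\<omega>. ?f (U n \<omega>))"
        using f01 by (auto intro!: integrable_const_bound[of _ 1])
      have i2: "integrable M (indicator ?B :: 'a \<Rightarrow> real)"
        by (rule integrable_const_bound[of _ 1]) auto
      have "\<bar>expectation (\<lambda>\<omega>. ?f (V n \<omega>)) - expectation (\<lambda>\<omega>. ?f (U n \<omega>))\<bar> =
        \<bar>expectation (\<lambda>\<omega>. ?f (V n \<omega>) - ?f (U n \<omega>))\<bar>" using i1 by simp
      also have "\<dots> \<le> expectation (\<lambda>\<omega>. \<bar>?f (V n \<omega>) - ?f (U n \<omega>)\<bar>)"
        by (rule integral_abs_bound)
      also have "\<dots> \<le> expectation (\<lambda>\<omega>. e / 2 + indicator ?B \<omega>)"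
      proof (rule integral_mono)
        show "integrable M (\<lambda>\<omega>. \<bar>?f (V n \<omega>) - ?f (U n \<omega>)\<bar>)" using i1 by simp
        show "integrable M (\<lambda>\<omega>. e / 2 + indicator ?B \<omega>)" using i2 by simp
        fix \<omega> assume "\<omega> \<in> space M"
        show "\<bar>?f (V n \<omega>) - ?f (U n \<omega>)\<bar> \<le> e / 2 + indicator ?B \<omega>"
        proof (cases "\<omega> \<in> ?B")
          case True
          then show ?thesis using f01[of "V n \<omega>"] f01[of "U n \<omega>"] e by (simp add: abs_le_iff)
        next
          case False
          then have "dist (V n \<omega>) (U n \<omega>) < d"
            using \<open>\<omega> \<in> space M\<close> d(1) by (auto simp: dist_real_def)
          from d(2)[OF this] False show ?thesis by (simp add: dist_real_def)
        qed
      qed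
      also have "\<dots> = e / 2 + prob ?B" using i2 by (simp add: prob_space)
      finally show ?case using elim by simp
    qed
    then show "\<exists>no. \<forall>n\<ge>no. norm (expectation (\<lambda>\<omega>. ?f (V n \<omega>)) - expectation (\<lambda>\<omega>. ?f (U n \<omega>)) - 0) < e"
      by (simp add: eventually_sequentially)
  qed
  from tendsto_add[OF this conv[OF xy]]
  show "(\<lambda>n. integral\<^sup>L (distr M borel (V n)) ?f) \<longlonglongrightarrow> integral\<^sup>L L ?f"
    by (simp add: integral_distr)
qed (simp add: V)

text \<open>The constant 1 is an admissible test function. Applied to the centring vectors, this
  yields the total mass of the limiting \<open>mvnormal\<close> without integrating its
  density.\<close>

lemma weak_conv_vec_prob_space:
  fixes \<mu> :: "nat \<Rightarrow> 'a::euclidean_space measure"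
  assumes conv: "weak_conv_vec \<mu> N" and \<mu>: "\<forall>\<^sub>F n in sequentially. prob_space (\<mu> n)"
  shows "prob_space N"
proof (rule prob_spaceI)
  have "(\<lambda>n. \<integral>z. 1 \<partial>\<mu> n) \<longlonglongrightarrow> (\<integral>z. (1::real) \<partial>N)"
    using conv[unfolded weak_conv_vec_def, rule_format, of "\<lambda>_. 1"] by (simp add: image_constant_conv)
  moreover have "(\<lambda>n. \<integral>z. (1::real) \<partial>\<mu> n) \<longlonglongrightarrow> 1"
    by (rule tendsto_eventually, use \<mu> in eventually_elim) (simp add: prob_space.prob_space)
  ultimately have "measure N (space N) = 1" using LIMSEQ_unique by fastforce
  then show "emeasure N (space N) = 1"
    by (cases "emeasure N (space N)") (auto simp: measure_def)
qed

text \<open>A real supremum dominates its members only if they are bounded. Masses are required to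
  be at most one, not equal to one, so that a vanishing posterior is covered.\<close>

lemma measure_diff_le_TV_dist:
  assumes "\<And>B. measure \<mu> B \<le> 1" "\<And>B. measure \<nu> B \<le> 1" "A \<in> sets borel"
  shows "\<bar>measure \<mu> A - measure \<nu> A\<bar> \<le> TV_dist \<mu> \<nu>"
  unfolding TV_dist_def
proof (rule cSUP_upper[OF assms(3)], rule bdd_aboveI2)
  show "\<bar>measure \<mu> B - measure \<nu> B\<bar> \<le> 1" for B
    using assms(1,2)[of B] measure_nonneg[of \<mu> B] measure_nonneg[of \<nu> B] by linarith
qed

section \<open>Convergence in distribution of the posterior value at risk\<close>

theorem theorem4p2:
  fixes \<Theta> :: "(real^'l) set" and \<Xi> :: "(real^'m) set" and X :: "(real^'d) set"
    and \<pi> :: "(real^'l) measure"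
    and P :: "real^'l \<Rightarrow> (real^'m) measure"
    and \<nu> :: "nat \<Rightarrow> (nat \<Rightarrow> real^'m) measure"
    and p :: "nat \<Rightarrow> real^'l \<Rightarrow> (nat \<Rightarrow> real^'m) \<Rightarrow> real"
    and h :: "real^'d \<Rightarrow> real^'m \<Rightarrow> real"
    and \<theta>c gradH :: "real^'l" and x :: "real^'d"
    and J :: "real^'l^'l"
    and \<Delta> :: "nat \<Rightarrow> (nat \<Rightarrow> real^'m) \<Rightarrow> real^'l"
    and \<alpha> \<sigma> :: real
  assumes prior: "prob_space \<pi>" "sets \<pi> = sets (borel_on \<Theta>)"
    and model: "\<And>\<theta>. \<theta> \<in> \<Theta> \<Longrightarrow> prob_space (P \<theta>)"
      "\<And>\<theta>. \<theta> \<in> \<Theta> \<Longrightarrow> sets (P \<theta>) = sets (borel_on \<Xi>)"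
    and kernel: "\<And>B. B \<in> sets (sequence_space \<Xi>) \<Longrightarrow>
      (\<lambda>\<theta>. measure (sequence_law (P \<theta>)) B) \<in> borel_measurable (borel_on \<Theta>)"
    and true_param: "\<theta>c \<in> \<Theta>"
    and decision: "closed X" "x \<in> X"
    and H_finite: "\<And>x \<theta>. x \<in> X \<Longrightarrow> \<theta> \<in> \<Theta> \<Longrightarrow> integrable (P \<theta>) (h x)"
    and i: "compact \<Theta>"
    and ii: "\<And>n. n \<ge> 1 \<Longrightarrow> sigma_finite_measure (\<nu> n)"
      "\<And>n. n \<ge> 1 \<Longrightarrow> sets (\<nu> n) = sets (sample_space n \<Xi>)"
      "\<And>n. n \<ge> 1 \<Longrightarrow>
         (\<lambda>(\<theta>, y). p n \<theta> y) \<in> borel_measurable (borel_on \<Theta> \<Otimes>\<^sub>M sample_space n \<Xi>)"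
      "\<And>n \<theta> y. n \<ge> 1 \<Longrightarrow> \<theta> \<in> \<Theta> \<Longrightarrow> y \<in> space (sample_space n \<Xi>) \<Longrightarrow> 0 \<le> p n \<theta> y"
      "\<And>n \<theta>. n \<ge> 1 \<Longrightarrow> \<theta> \<in> \<Theta> \<Longrightarrow>
         sample_law n (P \<theta>) = density (\<nu> n) (\<lambda>y. ennreal (p n \<theta> y))"
    and iii: "\<And>V. borel_nbhd \<Theta> \<theta>c V \<Longrightarrow> \<exists>\<phi>. uniformly_consistent_tests \<Theta> \<Xi> P \<theta>c V \<phi>"
    and iv: "\<And>\<epsilon> V. \<epsilon> > 0 \<Longrightarrow> borel_nbhd \<Theta> \<theta>c V \<Longrightarrow>
      \<exists>W\<in>sets \<pi>. W \<subseteq> V \<and> measure \<pi> W > 0 \<and>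
        (\<forall>\<theta>\<in>W. KL_div (density (\<nu> 1) (\<lambda>y. ennreal (p 1 \<theta>c y)))
                         (density (\<nu> 1) (\<lambda>y. ennreal (p 1 \<theta> y))) < ereal \<epsilon>)"
    and v: "\<exists>\<gamma>>0. \<forall>\<epsilon>>0. \<exists>M>0. \<forall>n\<ge>1.
      measure (sequence_law (P \<theta>c))
        {\<omega> \<in> space (sequence_law (P \<theta>c)).
           (\<integral>\<theta>. norm (sqrt (real n) *\<^sub>R (\<theta> - \<theta>c)) powr (1 + \<gamma>) \<partial>posterior \<pi> p n \<omega>) > M} < \<epsilon>"
    and vi_fisher: "has_fisher_information (sample_law 1 (P \<theta>c)) (p 1) \<Theta> \<theta>c J" "invertible J"
    and vi_centering: "\<And>n. n \<ge> 1 \<Longrightarrow> \<Delta> n \<in> borel_measurable (sample_space n \<Xi>)"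
      "weak_conv_vec (\<lambda>n. distr (sequence_law (P \<theta>c)) borel (\<lambda>\<omega>. \<Delta> n (restrict \<omega> {..<n})))
         (mvnormal 0 (matrix_inv J))"
    and vi_bvm: "conv_in_prob (sequence_law (P \<theta>c))
      (\<lambda>n \<omega>. TV_dist
          (distr (posterior \<pi> p n \<omega>) borel (\<lambda>\<theta>. sqrt (real n) *\<^sub>R (\<theta> - \<theta>c)))
          (mvnormal (\<Delta> n (restrict \<omega> {..<n})) (matrix_inv J))) 0"
    and vi_mean: "weak_conv_vec
      (\<lambda>n. distr (sequence_law (P \<theta>c)) borel
         (\<lambda>\<omega>. sqrt (real n) *\<^sub>R ((\<integral>\<theta>. \<theta> \<partial>posterior \<pi> p n \<omega>) - \<theta>c)))
      (mvnormal 0 (matrix_inv J))"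
    and vii: "(expected_cost P h x has_derivative (\<lambda>v. gradH \<bullet> v)) (at \<theta>c within \<Theta>)"
    and viii: "AE \<omega> in sequence_law (P \<theta>c). \<forall>n\<ge>1.
      has_positive_density_on
        (distr (posterior \<pi> p n \<omega>) borel (\<lambda>\<theta>. sqrt (real n) *\<^sub>R (\<theta> - \<theta>c)))
        ((\<lambda>\<theta>. sqrt (real n) *\<^sub>R (\<theta> - \<theta>c)) ` \<Theta>) \<and>
      has_positive_density_on
        (distr (posterior \<pi> p n \<omega>) borel
           (\<lambda>\<theta>. sqrt (real n) * (expected_cost P h x \<theta> - expected_cost P h x \<theta>c)))
        ((\<lambda>\<theta>. sqrt (real n) * (expected_cost P h x \<theta> - expected_cost P h x \<theta>c)) ` \<Theta>)"
    and alpha: "0 < \<alpha>" "\<alpha> < 1"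
    and sigma: "\<sigma> = sqrt (gradH \<bullet> (matrix_inv J *v gradH))"
  shows "weak_conv_m
    (\<lambda>n. distr (sequence_law (P \<theta>c)) borel
       (\<lambda>\<omega>. sqrt (real n) *
          (VaR \<alpha> (posterior \<pi> p n \<omega>) (expected_cost P h x) - expected_cost P h x \<theta>c)))
    (normal_law (\<sigma> * inv std_normal_cdf \<alpha>) \<sigma>)"
proof -
  let ?M = "sequence_law (P \<theta>c)"
  let ?N = "mvnormal 0 (matrix_inv J)"
  define H where "H = expected_cost P h x"
  define D where "D n \<omega> = \<Delta> n (restrict \<omega> {..<n})" for n and \<omega> :: "nat \<Rightarrow> real^'m"
  define V where "V n \<omega> = sqrt (real n) * (VaR \<alpha> (posterior \<pi> p n \<omega>) H - H \<theta>c)" for n \<omega>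
  define a where "a = \<sigma> * inv std_normal_cdf \<alpha>"
  define U where "U n \<omega> = gradH \<bullet> D n \<omega> + a" for n \<omega>
  interpret M: prob_space ?M by (rule prob_space_PiM) (rule model(1)[OF true_param])
  have setsM: "sets ?M = sets (sequence_space \<Xi>)"
    by (rule sets_PiM_cong) (simp_all add: model(2)[OF true_param])
  have sp\<pi>: "space \<pi> = \<Theta>"
    using sets_eq_imp_space_eq[OF prior(2)] by (simp add: space_restrict_space)
  have Hm[measurable]: "H \<in> borel_measurable \<pi>"
    unfolding H_def measurable_cong_sets[OF prior(2) refl]
    using model kernel true_param H_finite[OF decision(2) true_param]
    by (rule borel_measurable_expected_cost)
  have pm: "(\<lambda>(\<theta>, y). p n \<theta> y) \<in> borel_measurable (\<pi> \<Otimes>\<^sub>M sample_space n \<Xi>)" if "n \<ge> 1" for n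
    using ii(3)[OF that] measurable_cong_sets[OF sets_pair_measure_cong[OF prior(2) refl] refl] by blast
  have r: "(\<lambda>\<omega>. restrict \<omega> {..<n}) \<in> measurable ?M (sample_space n \<Xi>)" for n
    unfolding measurable_cong_sets[OF setsM refl] by (rule measurable_restrict_subset) simp
  have Dm[measurable]: "D n \<in> borel_measurable ?M" if "n \<ge> 1" for n
    using measurable_compose[OF r vi_centering(1)[OF that]] by (simp add: D_def[abs_def])
  \<comment> \<open>The joint measurability of \<open>p n\<close> is available from
    \<open>n = 1\<close> on; for \<open>n = 0\<close> the factor \<open>sqrt 0\<close> makes
    \<open>V 0\<close> vanish.\<close>
  have Vm: "V n \<in> borel_measurable ?M" for n
  proof (cases "n = 0")
    case True
    then show ?thesis by (simp add: V_def[abs_def])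
  next
    case False
    then have n: "n \<ge> 1" by simp
    note [measurable] = borel_measurable_VaR_posterior[where p = p and n = n, OF prior(1) Hm pm[OF n] setsM alpha]
    show ?thesis unfolding V_def[abs_def] by measurable
  qed
  have \<mu>_prob: "\<forall>\<^sub>F n in sequentially. prob_space (distr ?M borel (D n))"
    using eventually_ge_at_top[of "1::nat"] by eventually_elim (intro M.prob_space_distr Dm)
  have centering: "weak_conv_vec (\<lambda>n. distr ?M borel (D n)) ?N"
    using vi_centering(2) by (simp add: D_def[abs_def])
  have N: "prob_space ?N" by (rule weak_conv_vec_prob_space[OF centering \<mu>_prob])
  interpret N: prob_space ?N by fact
  note sym = fisher_information_sym[OF vi_fisher(1)] and nonneg = fisher_information_nonneg[OF vi_fisher(1)]
    and eq0 = fisher_information_eq_0[OF vi_fisher(1)]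
  have \<sigma>0: "\<sigma> \<ge> 0"
    using distr_mvnormal_inner(1)[OF sym nonneg eq0 vi_fisher(2) N] by (simp add: sigma)
  have marg: "distr ?N borel (\<lambda>z. gradH \<bullet> z) = normal_law 0 \<sigma>"
    using distr_mvnormal_inner(2)[OF sym nonneg eq0 vi_fisher(2) N] by (simp add: sigma)
  have marg_cdf: "N.prob {z. gradH \<bullet> z \<le> t} = measure (normal_law 0 \<sigma>) {..t}" for t
    unfolding marg[symmetric] by (subst measure_distr) (auto simp: vimage_def)
  have marg_a: "distr ?N borel (\<lambda>z. gradH \<bullet> z + a) = normal_law a \<sigma>"
  proof -
    have "normal_law a \<sigma> = distr (normal_law 0 \<sigma>) borel (\<lambda>y. y + a)"
      by (subst (1 2) normal_law_standardize[OF \<sigma>0]) (subst distr_distr, auto simp: comp_def add.commute normal_law_def)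
    also have "\<dots> = distr ?N borel (\<lambda>z. gradH \<bullet> z + a)"
      unfolding marg[symmetric] by (subst distr_distr) (auto simp: comp_def)
    finally show ?thesis ..
  qed
  have Um: "\<forall>\<^sub>F n in sequentially. U n \<in> borel_measurable ?M"
    using eventually_ge_at_top[of "1::nat"]
  proof eventually_elim
    case (elim n)
    note [measurable] = Dm[OF elim]
    show ?case unfolding U_def[abs_def] by measurable
  qed
  have limit: "(\<lambda>n. M.expectation (\<lambda>\<omega>. cts_step s t (U n \<omega>))) \<longlonglongrightarrow> integral\<^sup>L (normal_law a \<sigma>) (cts_step s t)"
    if st: "s < t" for s t
  proof -
    have cont: "continuous_on UNIV (cts_step s t)"
      by (intro uniformly_continuous_imp_continuous cts_step_uniformly_continuous st)
    have [measurable]: "cts_step s t \<in> borel_measurable borel"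
      by (rule borel_measurable_continuous_onI[OF cont])
    \<comment> \<open>Composing the step with an affine functional gives a bounded continuous
      function on the vector space, so convergence of the centring vectors applies directly.\<close>
    let ?f = "\<lambda>z. cts_step s t (gradH \<bullet> z + a)"
    have "continuous_on UNIV ?f"
      by (rule continuous_on_compose2[OF cont]) (auto intro!: continuous_intros)
    moreover have "bounded (range ?f)"
      using st by (auto simp: bounded_iff cts_step_def intro!: exI[of _ 1])
    ultimately have "(\<lambda>n. \<integral>z. ?f z \<partial>distr ?M borel (D n)) \<longlonglongrightarrow> (\<integral>z. ?f z \<partial>?N)"
      using centering unfolding weak_conv_vec_def by blast
    moreover have "(\<integral>z. ?f z \<partial>?N) = integral\<^sup>L (normal_law a \<sigma>) (cts_step s t)"
      unfolding marg_a[symmetric] by (subst integral_distr) auto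
    moreover have "\<forall>\<^sub>F n in sequentially. (\<integral>z. ?f z \<partial>distr ?M borel (D n)) = M.expectation (\<lambda>\<omega>. cts_step s t (U n \<omega>))"
      using eventually_ge_at_top[of "1::nat"]
      by eventually_elim (subst integral_distr, auto simp: U_def Dm)
    ultimately show ?thesis using Lim_transform_eventually by fastforce
  qed
  have diff: "(\<lambda>n. M.prob {\<omega> \<in> space ?M. \<eta> < \<bar>V n \<omega> - U n \<omega>\<bar>}) \<longlonglongrightarrow> 0" if "\<eta> > 0" for \<eta>
  proof (rule order_tendstoI)
    \<comment> \<open>Linearisation locates the value at risk only within
      \<open>2 * \<delta>\<close>, so half of \<eta> is used.\<close>
    define \<delta> where "\<delta> = \<eta> / 2"
    have \<delta>: "\<delta> > 0" using that by (simp add: \<delta>_def)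
    fix e :: real assume e: "0 < e"
    let ?T = "\<lambda>n \<omega>. TV_dist (distr (posterior \<pi> p n \<omega>) borel (\<lambda>\<theta>. sqrt (real n) *\<^sub>R (\<theta> - \<theta>c)))
          (mvnormal (\<Delta> n (restrict \<omega> {..<n})) (matrix_inv J))"
    have gap: "\<alpha> < N.prob {z. gradH \<bullet> z \<le> a + \<delta>}" "N.prob {z. gradH \<bullet> z \<le> a - \<delta>} < \<alpha>"
      unfolding marg_cdf a_def using normal_law_quantile[OF alpha \<sigma>0 \<delta>] by auto
    define G where "G = min (N.prob {z. gradH \<bullet> z \<le> a + \<delta>} - \<alpha>) (\<alpha> - N.prob {z. gradH \<bullet> z \<le> a - \<delta>})"
    have G: "0 < G" "G \<le> N.prob {z. gradH \<bullet> z \<le> a + \<delta>} - \<alpha>" "G \<le> \<alpha> - N.prob {z. gradH \<bullet> z \<le> a - \<delta>}"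
      using gap by (auto simp: G_def)
    \<comment> \<open>\<open>G / 4\<close> keeps the total loss \<open>3 * \<tau>\<close> strictly
      inside the gap around \<alpha>; the cap \<open>1/2\<close> keeps \<tau> below 1, which later
      excludes a vanishing posterior.\<close>
    define \<tau> where "\<tau> = min (1/2) (G / 4)"
    have "0 < \<tau>" "\<tau> < 1" "\<tau> \<le> G / 4" using G(1) by (auto simp: \<tau>_def)
    then have \<tau>: "0 < \<tau>" "\<tau> < 1" "\<alpha> \<le> N.prob {z. gradH \<bullet> z \<le> a + \<delta>} - 3 * \<tau>"
        "N.prob {z. gradH \<bullet> z \<le> a - \<delta>} + 3 * \<tau> < \<alpha>"
      using G by linarith+
    obtain K1 where K1: "K1 > 0" "N.prob {z. norm z > K1} < \<tau>"
      using prob_tail_bound[OF N _ \<tau>(1)] by auto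
    obtain K2 where K2: "K2 > 0" "\<forall>\<^sub>F n in sequentially. measure (distr ?M borel (D n)) {z. norm z > K2} < e / 2"
      using weak_conv_vec_tight[OF centering N _ _ \<mu>_prob, of "e / 2"] e by auto
    \<comment> \<open>\<open>K1\<close> bounds the normal fluctuation and \<open>K2\<close> the
      centre; each has to fit into half of \<open>K\<close>.\<close>
    define K where "K = 2 * max K1 K2"
    have K: "K > 0" "K1 \<le> K / 2" "K2 \<le> K / 2" using K1 K2 by (auto simp: K_def)
    have "N.prob {z. norm z > K / 2} \<le> N.prob {z. norm z > K1}"
      using K by (intro N.finite_measure_mono) auto
    then have tail: "N.prob {z. norm z > K / 2} \<le> \<tau>" using K1 by linarith
    \<comment> \<open>The relative error \<open>\<delta> / K\<close> is chosen so that, after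
      scaling by \<open>sqrt n\<close>, the remainder is at most \<delta> wherever the scaled
      deviation has norm at most \<open>K\<close>. Such deviations lie within \<open>d\<close> once
      \<open>sqrt n * d\<close> exceeds \<open>K\<close>.\<close>
    obtain d where d: "d > 0" "\<And>\<theta>. \<theta> \<in> \<Theta> \<Longrightarrow> norm (\<theta> - \<theta>c) < d \<Longrightarrow>
        \<bar>H \<theta> - H \<theta>c - gradH \<bullet> (\<theta> - \<theta>c)\<bar> \<le> \<delta> / K * norm (\<theta> - \<theta>c)"
    proof -
      have "\<delta> / K > 0" using \<delta> K(1) by simp
      then have "\<exists>d>0. \<forall>\<theta>\<in>\<Theta>. norm (\<theta> - \<theta>c) < d \<longrightarrow>
          norm (H \<theta> - H \<theta>c - gradH \<bullet> (\<theta> - \<theta>c)) \<le> \<delta> / K * norm (\<theta> - \<theta>c)"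
        using vii[folded H_def] unfolding has_derivative_within_alt by blast
      then show ?thesis using that unfolding real_norm_def by blast
    qed
    have "filterlim (\<lambda>n. sqrt (real n) * d) at_top sequentially"
      using d(1) by (intro filterlim_at_top_mult_tendsto_pos[OF tendsto_const] filterlim_compose[OF sqrt_at_top filterlim_real_sequentially])
    then have large: "\<forall>\<^sub>F n in sequentially. K < sqrt (real n) * d"
      by (simp add: filterlim_at_top_dense)
    have TV_small: "\<forall>\<^sub>F n in sequentially. M.prob {\<omega> \<in> space ?M. \<tau> < \<bar>?T n \<omega> - 0\<bar>} < e / 2"
    proof (rule order_tendstoD(2))
      show "(\<lambda>n. M.prob {\<omega> \<in> space ?M. \<tau> < \<bar>?T n \<omega> - 0\<bar>}) \<longlonglongrightarrow> 0"
        using vi_bvm \<tau>(1) unfolding conv_in_prob_def by blast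
    qed (use e in simp)
    show "\<forall>\<^sub>F n in sequentially. M.prob {\<omega> \<in> space ?M. \<eta> < \<bar>V n \<omega> - U n \<omega>\<bar>} < e"
      using eventually_ge_at_top[of "1::nat"] large TV_small K2(2)
    proof eventually_elim
      case (elim n)
      note [measurable] = Dm[OF elim(1)]
      have Tm[measurable]: "?T n \<in> borel_measurable ?M" using vi_bvm unfolding conv_in_prob_def by blast
      let ?B1 = "{\<omega> \<in> space ?M. \<tau> < \<bar>?T n \<omega> - 0\<bar>}"
      let ?B2 = "{\<omega> \<in> space ?M. norm (D n \<omega>) > K2}"
      have rn: "sqrt (real n) > 0" using elim(1) by simp
      \<comment> \<open>This is deterministic: outside the two bad events, each of probability below
        \<open>e / 2\<close>, the normal approximation holds for the given sample.\<close>
      have close: "\<bar>V n \<omega> - U n \<omega>\<bar> \<le> \<eta>"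
        if \<omega>: "\<omega> \<in> space ?M" and T: "\<bar>?T n \<omega>\<bar> \<le> \<tau>" and D: "norm (D n \<omega>) \<le> K2" for \<omega>
      proof -
        let ?Q = "posterior \<pi> p n \<omega>"
        let ?Z = "\<lambda>\<theta>. sqrt (real n) *\<^sub>R (\<theta> - \<theta>c)"
        let ?Y = "\<lambda>\<theta>. sqrt (real n) * (H \<theta> - H \<theta>c)"
        have setsQ: "sets ?Q = sets (borel_on \<Theta>)" and spQ: "space ?Q = \<Theta>"
          by (simp_all add: posterior_def prior(2) sp\<pi>)
        have HQ[measurable]: "H \<in> borel_measurable ?Q" using Hm by (simp add: posterior_def)
        have Zm[measurable]: "?Z \<in> borel_measurable ?Q"
          unfolding measurable_cong_sets[OF setsQ refl] by (rule measurable_restrict_space1) simp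
        have Ym[measurable]: "?Y \<in> borel_measurable ?Q" by measurable
        have "restrict \<omega> {..<n} \<in> space (sample_space n \<Xi>)"
          using measurable_space[OF r \<omega>] .
        then have sec: "(\<lambda>\<theta>. p n \<theta> (restrict \<omega> {..<n})) \<in> borel_measurable \<pi>"
          using measurable_Pair1[OF pm[OF elim(1)]] by simp
        interpret S: prob_space "mvnormal (D n \<omega>) (matrix_inv J)"
          unfolding mvnormal_eq_distr[of "D n \<omega>"] by (rule N.prob_space_distr) measurable
        have TV: "\<bar>measure (distr ?Q borel ?Z) A - measure (mvnormal (D n \<omega>) (matrix_inv J)) A\<bar> \<le> \<tau>"
          if A: "A \<in> sets borel" and le1: "\<And>B. measure (distr ?Q borel ?Z) B \<le> 1" for A
          using measure_diff_le_TV_dist[OF le1 S.prob_le_1 A] T by (simp add: D_def)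
        \<comment> \<open>A zero posterior would differ from the normal law by 1 on the whole space,
          which exceeds \<tau>.\<close>
        have Q: "prob_space ?Q"
        proof (rule ccontr)
          assume "\<not> prob_space ?Q"
          then have null: "emeasure ?Q A = 0" for A using posterior_prob_or_null[where p = p, OF sec] by blast
          have "measure (distr ?Q borel ?Z) A = 0" for A
            by (cases "A \<in> sets borel") (auto simp: measure_def emeasure_distr null emeasure_notin_sets)
          then show False using TV[of UNIV] S.prob_space \<tau>(2) by simp
        qed
        interpret Q: prob_space ?Q by fact
        interpret QZ: prob_space "distr ?Q borel ?Z" by (rule Q.prob_space_distr) simp
        have TV': "\<bar>measure (distr ?Q borel ?Z) A - measure (distr ?N borel ((+) (D n \<omega>))) A\<bar> \<le> \<tau>"
          if "A \<in> sets borel" for A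
          using TV[OF that QZ.prob_le_1] by (simp add: mvnormal_eq_distr[of "D n \<omega>"])
        have R: "\<bar>?Y \<theta> - gradH \<bullet> ?Z \<theta>\<bar> \<le> \<delta>" if "\<theta> \<in> space ?Q" and Z: "norm (?Z \<theta>) \<le> K" for \<theta>
        proof -
          have Z': "sqrt (real n) * norm (\<theta> - \<theta>c) \<le> K" using Z by simp
          then have "sqrt (real n) * norm (\<theta> - \<theta>c) < sqrt (real n) * d" using elim(2) by simp
          then have "norm (\<theta> - \<theta>c) < d" using rn by simp
          then have b: "\<bar>H \<theta> - H \<theta>c - gradH \<bullet> (\<theta> - \<theta>c)\<bar> \<le> \<delta> / K * norm (\<theta> - \<theta>c)"
            using d(2) that(1) spQ by simp
          have "?Y \<theta> - gradH \<bullet> ?Z \<theta> = sqrt (real n) * (H \<theta> - H \<theta>c - gradH \<bullet> (\<theta> - \<theta>c))"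
            by (simp add: algebra_simps inner_diff_right)
          then have "\<bar>?Y \<theta> - gradH \<bullet> ?Z \<theta>\<bar> = sqrt (real n) * \<bar>H \<theta> - H \<theta>c - gradH \<bullet> (\<theta> - \<theta>c)\<bar>"
            by (simp add: abs_mult)
          also have "\<dots> \<le> sqrt (real n) * (\<delta> / K * norm (\<theta> - \<theta>c))"
            by (rule mult_left_mono[OF b]) simp
          also have "\<dots> = \<delta> / K * (sqrt (real n) * norm (\<theta> - \<theta>c))" by simp
          also have "\<dots> \<le> \<delta> / K * K" using \<delta> K(1) by (intro mult_left_mono Z') simp
          finally show ?thesis using K(1) by simp
        qed
        have YH: "{\<theta> \<in> space ?Q. ?Y \<theta> \<le> t} = {\<theta> \<in> space ?Q. H \<theta> \<le> H \<theta>c + t / sqrt (real n)}" for t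
          using rn by (auto simp: field_simps)
        have VaR: "VaR \<alpha> ?Q H \<le> H \<theta>c + t / sqrt (real n) \<longleftrightarrow> V n \<omega> \<le> t" for t
          unfolding V_def using rn by (auto simp: field_simps)
        have V_iff: "V n \<omega> \<le> t \<longleftrightarrow> \<alpha> \<le> Q.prob {\<theta> \<in> space ?Q. ?Y \<theta> \<le> t}" for t
          unfolding YH VaR[symmetric] by (rule VaR_le_iff[OF Q HQ alpha])
        have D': "norm (D n \<omega>) \<le> K / 2" using D K(3) by simp
        note bounds = linearised_cdf_bounds[OF Q Ym Zm N sets_mvnormal TV' R D' tail, of a]
        \<comment> \<open>At the upper threshold the posterior distribution function has reached
          \<alpha>, at the lower one it is still below; \<open>V_iff\<close> turns both facts into
          bounds on \<open>V n \<omega>\<close>.\<close>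
        have "V n \<omega> \<le> gradH \<bullet> D n \<omega> + a + 2 * \<delta>"
          using bounds(1) \<tau>(3) unfolding V_iff by linarith
        moreover have "\<not> V n \<omega> \<le> gradH \<bullet> D n \<omega> + a - 2 * \<delta>"
          using bounds(2) \<tau>(4) unfolding V_iff by linarith
        ultimately show ?thesis unfolding U_def \<delta>_def by (simp add: abs_le_iff)
      qed
      have "M.prob {\<omega> \<in> space ?M. \<eta> < \<bar>V n \<omega> - U n \<omega>\<bar>} \<le> M.prob (?B1 \<union> ?B2)"
      proof (rule M.finite_measure_mono)
        show "{\<omega> \<in> space ?M. \<eta> < \<bar>V n \<omega> - U n \<omega>\<bar>} \<subseteq> ?B1 \<union> ?B2"
          using close by (fastforce simp: not_less)
      qed measurable
      also have "\<dots> \<le> M.prob ?B1 + M.prob ?B2" by (rule measure_Un_le) measurable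
      also have "M.prob ?B2 = measure (distr ?M borel (D n)) {z. norm z > K2}"
        by (subst measure_distr) (auto intro!: arg_cong[where f = M.prob])
      finally show ?case using elim(3,4) by linarith
    qed
  qed (auto intro: always_eventually less_le_trans measure_nonneg)
  have "weak_conv_m (\<lambda>n. distr ?M borel (V n)) (normal_law a \<sigma>)"
    by (rule M.slutsky_weak_conv_m[OF Vm Um normal_law_real_distribution[OF \<sigma>0] diff limit])
  then show ?thesis by (simp add: V_def[abs_def] H_def a_def)
qed

end
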